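(* There exist systems $(X^-,F)$, $(W,F)$ and $(Z,H)$ (three systems; the letter $F$ denotes the map of the respective system), with metrics $D$ on $X^-$, $D$ on $W$ and $\rho$ on $Z$, such that: (i) Each of the three spaces is compact with respect to its metric, and each of the three maps is a homeomorphism of the respective space onto itself. (ii) For every $\varepsilon$ of the form $\varepsilon=3^{-n}$ with $n\in\mathbb N$, the following strict inequalities hold: $$\liminf_{T\to\infty}\frac{\ln \mathrm{span}(X^-,\varepsilon,D_T)}{T}<\limsup_{T\to\infty}\frac{\ln \mathrm{span}(X^-,\varepsilon,D_T)}{T},$$ $$\liminf_{T\to\infty}\frac{\ln \mathrm{sep}(X^-,\varepsilon,D_T)}{T}<\limsup_{T\to\infty}\frac{\ln \mathrm{sep}(X^-,\varepsilon,D_T)}{T},$$ $$\liminf_{T\to\infty}\frac{\ln \mathrm{sep}(W,\varepsilon,D_T)}{T}<\limsup_{T\to\infty}\frac{\ln \mathrm{sep}(W,\varepsilon,D_T)}{T},$$ $$\liminf_{T\to\infty}\frac{\ln \mathrm{span}(Z,\varepsilon,\rho_T)}{T}<\limsup_{T\to\infty}\frac{\ln \mathrm{span}(Z,\varepsilon,\rho_T)}{T}.$$ (iii3) For all $\delta>0$: $\liminf_{T\to\infty}\frac{\ln \mathrm{span}(W,\delta,D_T)}{T}=\limsup_{T\to\infty}\frac{\ln \mathrm{span}(W,\delta,D_T)}{T}$. (iii4) For all $\delta>0$: $\liminf_{T\to\infty}\frac{\ln \mathrm{sep}(Z,\delta,\rho_T)}{T}=\limsup_{T\to\infty}\frac{\ln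 \mathrm{sep}(Z,\delta,\rho_T)}{T}$.
   Context: $\mathbb N=\{0,1,2,\dots\}$. For a metric space $(X,D)$, a continuous map $F:X\to X$ and an integer $T\ge 1$, $D_T(x,y)=\max\{D(F^t(x),F^t(y)):0\le t\le T-1\}$ (and $\rho_T$ is defined likewise from $\rho$ and $H$). Limits as $T\to\infty$ are over positive integers. For a metric $\mu$ on $X$ and $\varepsilon>0$: a set of points is $\varepsilon$-separated if any two distinct points in it have $\mu$-distance $\ge\varepsilon$, and $\mathrm{sep}(X,\varepsilon,\mu)$ is the maximum size of an $\varepsilon$-separated subset of $X$; a set $S\subset X$ is $\varepsilon$-spanning if for all $x\in X$ there is $s\in S$ with $\mu(s,x)<\varepsilon$, and $\mathrm{span}(X,\varepsilon,\mu)$ is the minimum size of an $\varepsilon$-spanning subset of $X$. *)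

theory Defs
  imports "HOL-Analysis.Analysis"
begin

(* Existential quantification over types is not available, so the points of the spaces are taken
   from one fixed type of cardinality continuum; the space is the carrier set mspace of a metric.
   A compact metric space has at most continuum many points, so every compact metric system is
   isometrically conjugate to one of this form: the metric is arbitrary and need not be related to
   the product structure of the type. *)
type_synonym point = "nat \<Rightarrow> int \<Rightarrow> nat"

(* Meaningful for T \<ge> 1 only; the value at T = 0 does not affect limits as T tends to infinity. *)
definition orbit_dist :: "'a metric \<Rightarrow> ('a \<Rightarrow> 'a) \<Rightarrow> nat \<Rightarrow> 'a \<Rightarrow> 'a \<Rightarrow> real" where
  "orbit_dist m F T x y = Max ((\<lambda>t. mdist m ((F ^^ t) x) ((F ^^ t) y)) ` {..<T})"

definition separated_set :: "real \<Rightarrow> ('a \<Rightarrow> 'a \<Rightarrow> real) \<Rightarrow> 'a set \<Rightarrow> bool" where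
  "separated_set \<epsilon> \<mu> S \<longleftrightarrow> (\<forall>x\<in>S. \<forall>y\<in>S. x \<noteq> y \<longrightarrow> \<mu> x y \<ge> \<epsilon>)"

definition spanning_set :: "'a set \<Rightarrow> real \<Rightarrow> ('a \<Rightarrow> 'a \<Rightarrow> real) \<Rightarrow> 'a set \<Rightarrow> bool" where
  "spanning_set X \<epsilon> \<mu> S \<longleftrightarrow> (\<forall>x\<in>X. \<exists>s\<in>S. \<mu> s x < \<epsilon>)"

(* The finiteness conditions exclude infinite sets, whose card is 0 by convention. On a compact
   space with \<epsilon> > 0, the sizes of separated sets are bounded and finite spanning sets exist, so
   GREATEST and LEAST are attained. *)
definition sep_num :: "'a set \<Rightarrow> real \<Rightarrow> ('a \<Rightarrow> 'a \<Rightarrow> real) \<Rightarrow> nat" where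
  "sep_num X \<epsilon> \<mu> = (GREATEST n. \<exists>S. S \<subseteq> X \<and> finite S \<and> separated_set \<epsilon> \<mu> S \<and> card S = n)"

definition span_num :: "'a set \<Rightarrow> real \<Rightarrow> ('a \<Rightarrow> 'a \<Rightarrow> real) \<Rightarrow> nat" where
  "span_num X \<epsilon> \<mu> = (LEAST n. \<exists>S. S \<subseteq> X \<and> finite S \<and> spanning_set X \<epsilon> \<mu> S \<and> card S = n)"

(* Valued in ereal so that the complete-lattice liminf and limsup apply. *)
definition sep_rate :: "'a metric \<Rightarrow> ('a \<Rightarrow> 'a) \<Rightarrow> real \<Rightarrow> nat \<Rightarrow> ereal" where
  "sep_rate m F \<epsilon> T = ereal (ln (real (sep_num (mspace m) \<epsilon> (orbit_dist m F T))) / real T)"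

definition span_rate :: "'a metric \<Rightarrow> ('a \<Rightarrow> 'a) \<Rightarrow> real \<Rightarrow> nat \<Rightarrow> ereal" where
  "span_rate m F \<epsilon> T = ereal (ln (real (span_num (mspace m) \<epsilon> (orbit_dist m F T))) / real T)"

definition compact_homeo_system :: "'a metric \<Rightarrow> ('a \<Rightarrow> 'a) \<Rightarrow> bool" where
  "compact_homeo_system m F \<longleftrightarrow>
     compact_space (mtopology_of m) \<and> homeomorphic_map (mtopology_of m) (mtopology_of m) F"

end

theory Submission
  imports Defs "HOL-Real_Asymp.Real_Asymp"
begin

text \<open>
All three systems are shifts on sequences of tracks, where track \<open>m\<close> enters the metric with weight
\<open>3^(-m)\<close>. At scale \<open>\<epsilon> = 3^(-n)\<close> the tracks before \<open>n\<close> are fully visible and contribute \<open>n ln 6\<close> to every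
growth rate, the tracks after \<open>n\<close> are invisible, and on track \<open>n\<close> only symbol distances equal to 1 are
seen (\<open>orbit_dist_close\<close>). Oscillation is thus a question about a single track.

A track carries stars, left digits and right digits, with six digits on each side. Digits of both sides
occur only in blocks: \<open>12 a\<close> left digits, a gap of \<open>2 a + 1\<close> stars, and the mirror image of the left
digits as right digits, where the level \<open>a\<close> is an even factorial. A window of length \<open>T = (2k+1)!\<close> sees
at most one side of a block of level above \<open>(2k)!\<close>, while blocks up to that level fill a vanishing
proportion of it. A window of length \<open>27 a\<close> can see a whole block of level \<open>a\<close>. The limit inferior is
bounded along the former lengths and the limit superior along the latter.

Digits of one side have distance 1 only if they are adjacent in a graph attached to the side and the two
tracks agree on the whole past (left) or the whole future (right). Letting this distance approach 1
as the agreement gets longer makes the whole a metric (\<open>point_dist_triangle\<close>).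

Separated sets. The edges of the complete graph on five digits split into two pentagons, one used on the
left and one on the right. Both are triangle-free, so tracks that show one side contribute at most \<open>2^T\<close>
(\<open>card_first_difference_clique\<close>). In a whole block, the first left difference and its mirror image show the
same two digits, adjacent on one of the two sides, so all \<open>5^(12 a)\<close> blocks are separated
(\<open>block_close_imp_eq\<close>). Since \<open>5^4 > 2^9\<close>, the rate at \<open>T = 27 a\<close> is larger. This is a gain of the type
\<open>2 * 2 < 5\<close> known from the Shannon capacity of the pentagon.

Spanning sets. The sixth digit, the hub, is adjacent to no digit, hence it is within distance \<open>1/2\<close> of all
digits of its side. If blocks may contain hubs, then tracks filled with hubs dominate track \<open>n\<close> and the
spanning rate converges at every scale (\<open>span_size_hub_bounds\<close>). If they may not, then hubs still dominate
windows that see one side, but a block that is seen completely is dominated by itself only, so the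
spanning rate oscillates (\<open>span_size_le_one_sided\<close>, \<open>span_size_ge_blocks\<close>).

The first system has pentagons and no hubs in blocks: both rates oscillate. The second has pentagons and
hubs in blocks: only the separation rate oscillates. The third has complete graphs and no hubs in
blocks; there, left words of ordinary digits are already separated, and the separation rate converges
at every scale (\<open>sep_size_complete_bounds\<close>).
\<close>

section \<open>A metric on sequences of tracks\<close>

text \<open>Symbol 0 is the star, \<open>3 d + 1\<close> the digit \<open>d\<close> on the left and \<open>3 d + 2\<close> the digit \<open>d\<close> on the right; side 0
belongs to the star alone.\<close>

abbreviation side :: "nat \<Rightarrow> nat" where "side v \<equiv> v mod 3"

abbreviation dig :: "nat \<Rightarrow> nat" where "dig v \<equiv> v div 3"

text \<open>Equals \<open>3^(-r)\<close> for the nearest disagreement at distance \<open>r \<ge> 1\<close> from \<open>t\<close> in direction \<open>s\<close>, and 0 if there is none.\<close>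

definition tail_gap :: "int \<Rightarrow> (int \<Rightarrow> nat) \<Rightarrow> (int \<Rightarrow> nat) \<Rightarrow> int \<Rightarrow> real" where
  "tail_gap s x y t =
     (SUP r::nat. if x (t + s * int (Suc r)) = y (t + s * int (Suc r)) then 0 else (1/3) ^ Suc r)"

text \<open>Left digits look into the past and right digits into the future.\<close>

definition dir :: "nat \<Rightarrow> int" where
  "dir v = (if side v = 1 then - 1 else 1)"

text \<open>One graph on the digits for each side.\<close>

type_synonym digit_graph = "nat \<Rightarrow> nat \<Rightarrow> nat \<Rightarrow> bool"

text \<open>The value 1 for two digits on the same side requires an edge and agreement of the two tracks on the
whole past (left digits) or the whole future (right digits). Near agreement only lowers the value
slightly, which is what the triangle inequality of the metric below needs.\<close>

definition sym_dist :: "digit_graph \<Rightarrow> (int \<Rightarrow> nat) \<Rightarrow> (int \<Rightarrow> nat) \<Rightarrow> int \<Rightarrow> real" where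
  "sym_dist A x y t =
     (if x t = y t then 0
      else if side (x t) \<noteq> side (y t) then 1
      else if A (side (x t)) (dig (x t)) (dig (y t)) then 1 - tail_gap (dir (x t)) x y t / 2
      else 1/2)"

definition point_dist :: "digit_graph \<Rightarrow> point \<Rightarrow> point \<Rightarrow> real" where
  "point_dist A x y = (SUP (m, j). (1/3) ^ (m + nat \<bar>j\<bar>) * sym_dist A (x m) (y m) j)"

definition shift :: "point \<Rightarrow> point" where
  "shift x = (\<lambda>m t. x m (t + 1))"

text \<open>Digit 5 is the hub; the other five digits are called ordinary.\<close>

definition hub_isolated :: "digit_graph \<Rightarrow> bool" where
  "hub_isolated A \<longleftrightarrow> (\<forall>s d d'. A s d d' \<longrightarrow> A s d' d \<and> d < 5 \<and> d' < 5)"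

lemma tail_gap_bdd:
  "bdd_above (range (\<lambda>r::nat. if x (t + s * int (Suc r)) = y (t + s * int (Suc r)) then 0 else (1/3::real) ^ Suc r))"
  by (rule bdd_aboveI[of _ 1]) (auto simp: power_le_one simp del: power_Suc)

lemma tail_gap_ge:
  assumes "x (t + s * int (Suc r)) \<noteq> y (t + s * int (Suc r))"
  shows "(1/3) ^ Suc r \<le> tail_gap s x y t"
  unfolding tail_gap_def by (rule cSUP_upper2[where x=r, OF tail_gap_bdd UNIV_I]) (use assms in auto)

lemma tail_gap_leI:
  assumes "\<And>r. x (t + s * int (Suc r)) \<noteq> y (t + s * int (Suc r)) \<Longrightarrow> (1/3) ^ Suc r \<le> b" and "0 \<le> b"
  shows "tail_gap s x y t \<le> b"
  unfolding tail_gap_def by (rule cSUP_least) (use assms in auto)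

lemma tail_gap_nonneg: "0 \<le> tail_gap s x y t"
  unfolding tail_gap_def by (rule cSUP_upper2[where x=0, OF tail_gap_bdd UNIV_I]) auto

lemma tail_gap_le: "tail_gap s x y t \<le> 1/3"
proof (rule tail_gap_leI)
  fix r :: nat
  have "(1/3::real) ^ r \<le> 1" by (intro power_le_one) auto
  then show "(1/3::real) ^ Suc r \<le> 1/3" by simp
qed auto

lemma tail_gap_commute: "tail_gap s x y t = tail_gap s y x t"
  unfolding tail_gap_def by (simp add: eq_commute)

lemma tail_gap_eq_0_iff:
  "tail_gap s x y t = 0 \<longleftrightarrow> (\<forall>r. x (t + s * int (Suc r)) = y (t + s * int (Suc r)))"
proof
  assume *: "tail_gap s x y t = 0"
  have "(0::real) < (1/3) ^ Suc r" for r by simp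
  then show "\<forall>r. x (t + s * int (Suc r)) = y (t + s * int (Suc r))"
    using tail_gap_ge[of x t s _ y] * by (metis not_le)
next
  assume "\<forall>r. x (t + s * int (Suc r)) = y (t + s * int (Suc r))"
  then show "tail_gap s x y t = 0" by (auto simp: tail_gap_def)
qed

lemma tail_gap_ultra: "tail_gap s x z t \<le> tail_gap s x y t + tail_gap s y z t"
proof (rule tail_gap_leI)
  fix r assume "x (t + s * int (Suc r)) \<noteq> z (t + s * int (Suc r))"
  then have "x (t + s * int (Suc r)) \<noteq> y (t + s * int (Suc r)) \<or> y (t + s * int (Suc r)) \<noteq> z (t + s * int (Suc r))"
    by metis
  then show "(1/3) ^ Suc r \<le> tail_gap s x y t + tail_gap s y z t"
    using tail_gap_ge tail_gap_nonneg by (smt (verit))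
qed (use tail_gap_nonneg in \<open>auto intro: add_nonneg_nonneg\<close>)

lemma sym_dist_le_1: "sym_dist A x y t \<le> 1"
  using tail_gap_nonneg by (auto simp: sym_dist_def)

lemma sym_dist_ge_half: "x t \<noteq> y t \<Longrightarrow> 1/2 \<le> sym_dist A x y t"
  using tail_gap_le[of "dir (x t)" x y t] by (auto simp: sym_dist_def)

lemma sym_dist_nonneg: "0 \<le> sym_dist A x y t"
  using sym_dist_ge_half[of x t y A] by (cases "x t = y t") (auto simp: sym_dist_def)

lemma sym_dist_same: "x t = y t \<Longrightarrow> sym_dist A x y t = 0"
  by (simp add: sym_dist_def)

lemma sym_dist_commute: "hub_isolated A \<Longrightarrow> sym_dist A x y t = sym_dist A y x t"
  by (auto simp: sym_dist_def tail_gap_commute[of _ x y] dir_def hub_isolated_def)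

lemma dist_term_le:
  "(1/3) ^ (m + nat \<bar>j\<bar>) * sym_dist A (x m) (y m) j \<le> (1/3) ^ (m + nat \<bar>j\<bar>)"
  using sym_dist_le_1 by (intro mult_left_le) auto

lemma point_dist_bdd:
  "bdd_above (range (\<lambda>(m, j). (1/3) ^ (m + nat \<bar>j\<bar>) * sym_dist A (x m) (y m) j))"
proof (rule bdd_aboveI[of _ 1], clarsimp simp del: power_one_over)
  fix m :: nat and j :: int
  show "(1/3) ^ (m + nat \<bar>j\<bar>) * sym_dist A (x m) (y m) j \<le> 1"
    by (rule order_trans[OF dist_term_le]) (auto intro: power_le_one)
qed

lemma point_dist_ge: "(1/3) ^ (m + nat \<bar>j\<bar>) * sym_dist A (x m) (y m) j \<le> point_dist A x y"
  unfolding point_dist_def by (rule cSUP_upper2[where x="(m, j)", OF point_dist_bdd UNIV_I]) auto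

lemma point_dist_leI:
  assumes "\<And>m j. (1/3) ^ (m + nat \<bar>j\<bar>) * sym_dist A (x m) (y m) j \<le> b"
  shows "point_dist A x y \<le> b"
  unfolding point_dist_def by (rule cSUP_least) (use assms in auto)

lemma point_dist_nonneg: "0 \<le> point_dist A x y"
  by (rule order_trans[OF _ point_dist_ge[of 0 0]]) (simp add: sym_dist_nonneg)

lemma half_weight_le_point_dist:
  assumes "x m j \<noteq> y m j"
  shows "(1/3) ^ (m + nat \<bar>j\<bar>) * (1/2) \<le> point_dist A x y"
proof -
  have "(1/3) ^ (m + nat \<bar>j\<bar>) * (1/2) \<le> (1/3) ^ (m + nat \<bar>j\<bar>) * sym_dist A (x m) (y m) j"
    by (intro mult_left_mono sym_dist_ge_half assms) auto
  then show ?thesis using point_dist_ge order_trans by blast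
qed

text \<open>A disagreement at distance \<open>r\<close> from \<open>j\<close> has weight at least \<open>3^(-r)\<close> times the weight of \<open>j\<close>, and at
least half of its weight counts in the distance.\<close>

lemma weighted_tail_gap_le_point_dist:
  assumes s: "\<bar>s\<bar> = 1"
  shows "(1/3) ^ (m + nat \<bar>j\<bar>) * (tail_gap s (x m) (y m) j / 2) \<le> point_dist A x y"
proof -
  have "tail_gap s (x m) (y m) j \<le> 2 * point_dist A x y * 3 ^ (m + nat \<bar>j\<bar>)"
  proof (rule tail_gap_leI)
    fix r assume "x m (j + s * int (Suc r)) \<noteq> y m (j + s * int (Suc r))"
    from half_weight_le_point_dist[where A=A and x=x and y=y, OF this]
    have 1: "(1/3) ^ (m + nat \<bar>j + s * int (Suc r)\<bar>) * (1/2) \<le> point_dist A x y" .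
    have "\<bar>j + s * int (Suc r)\<bar> \<le> \<bar>j\<bar> + int (Suc r)"
      using s by (auto simp: abs_if split: if_splits)
    then have "(1/3::real) ^ (m + nat \<bar>j\<bar> + Suc r) \<le> (1/3) ^ (m + nat \<bar>j + s * int (Suc r)\<bar>)"
      by (intro power_decreasing) auto
    with 1 have "(1/3) ^ (m + nat \<bar>j\<bar> + Suc r) \<le> 2 * point_dist A x y" by linarith
    then have "(1/3) ^ (m + nat \<bar>j\<bar> + Suc r) * 3 ^ (m + nat \<bar>j\<bar>) \<le> 2 * point_dist A x y * 3 ^ (m + nat \<bar>j\<bar>)"
      by (intro mult_right_mono) auto
    also have "(1/3::real) ^ (m + nat \<bar>j\<bar> + Suc r) * 3 ^ (m + nat \<bar>j\<bar>) = (1/3) ^ Suc r"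
      unfolding power_add[of _ "m + nat \<bar>j\<bar>"] by (simp add: power_one_over)
    finally show "(1/3) ^ Suc r \<le> 2 * point_dist A x y * 3 ^ (m + nat \<bar>j\<bar>)" .
  qed (use point_dist_nonneg in auto)
  then have "(1/3) ^ (m + nat \<bar>j\<bar>) * (tail_gap s (x m) (y m) j / 2)
      \<le> (1/3) ^ (m + nat \<bar>j\<bar>) * ((2 * point_dist A x y * 3 ^ (m + nat \<bar>j\<bar>)) / 2)"
    by (intro mult_left_mono divide_right_mono) auto
  also have "\<dots> = point_dist A x y" by (simp add: power_one_over)
  finally show ?thesis .
qed

text \<open>Here the symbol distance is not a function of the two symbols alone: replacing \<open>x\<close> by a track \<open>y\<close>
with the same symbol at \<open>j\<close> can change it, but by at most half the tail gap between \<open>x\<close> and \<open>y\<close>.\<close>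

lemma weighted_sym_dist_triangle:
  assumes A: "hub_isolated A" and eq: "x m j = y m j"
  shows "(1/3) ^ (m + nat \<bar>j\<bar>) * sym_dist A (x m) (z m) j \<le> point_dist A x y + point_dist A y z"
proof -
  let ?w = "(1/3::real) ^ (m + nat \<bar>j\<bar>)"
  let ?s = "dir (x m j)"
  have "sym_dist A (x m) (z m) j \<le> tail_gap ?s (x m) (y m) j / 2 + sym_dist A (y m) (z m) j"
    using eq tail_gap_ultra[of ?s "y m" "z m" j "x m"] tail_gap_nonneg[of ?s "x m" "y m" j]
    by (auto simp: sym_dist_def tail_gap_commute[of _ "y m" "x m"])
  then have "?w * sym_dist A (x m) (z m) j \<le> ?w * (tail_gap ?s (x m) (y m) j / 2 + sym_dist A (y m) (z m) j)"
    by (intro mult_left_mono) auto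
  also have "\<dots> = ?w * (tail_gap ?s (x m) (y m) j / 2) + ?w * sym_dist A (y m) (z m) j"
    by (simp only: distrib_left)
  also have "\<dots> \<le> point_dist A x y + point_dist A y z"
    by (intro add_mono weighted_tail_gap_le_point_dist point_dist_ge) (auto simp: dir_def)
  finally show ?thesis .
qed

lemma point_dist_commute: "hub_isolated A \<Longrightarrow> point_dist A x y = point_dist A y x"
  unfolding point_dist_def by (subst sym_dist_commute) auto

text \<open>At a position where \<open>y\<close> differs from both \<open>x\<close> and \<open>z\<close>, the bounds \<open>1/2\<close> and 1 on nonzero symbol distances
suffice; otherwise \<open>y\<close> shares its symbol with one of them and the preceding estimate applies.\<close>

lemma point_dist_triangle:
  assumes A: "hub_isolated A"
  shows "point_dist A x z \<le> point_dist A x y + point_dist A y z"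
proof (rule point_dist_leI)
  fix m j
  let ?w = "(1/3::real) ^ (m + nat \<bar>j\<bar>)"
  consider "x m j = y m j" | "z m j = y m j" | "x m j \<noteq> y m j" "y m j \<noteq> z m j" by metis
  then show "?w * sym_dist A (x m) (z m) j \<le> point_dist A x y + point_dist A y z"
  proof cases
    case 1
    then show ?thesis by (rule weighted_sym_dist_triangle[OF A])
  next
    case 2
    from weighted_sym_dist_triangle[where x=z and y=y and z=x, OF A this] show ?thesis
      by (simp add: sym_dist_commute[OF A, of "z m"] point_dist_commute[OF A, of z] point_dist_commute[OF A, of y x])
  next
    case 3
    have "?w * sym_dist A (x m) (z m) j \<le> ?w" by (rule dist_term_le)
    also have "\<dots> = ?w * (1/2) + ?w * (1/2)" by simp
    also have "\<dots> \<le> point_dist A x y + point_dist A y z"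
      by (intro add_mono half_weight_le_point_dist 3)
    finally show ?thesis .
  qed
qed

lemma point_dist_eq_0_iff: "point_dist A x y = 0 \<longleftrightarrow> x = y"
proof
  assume *: "point_dist A x y = 0"
  show "x = y"
  proof (intro ext, rule ccontr)
    fix m j assume "x m j \<noteq> y m j"
    from half_weight_le_point_dist[where A=A and x=x and y=y, OF this] * 
    have "(1/3::real) ^ (m + nat \<bar>j\<bar>) * (1/2) \<le> 0" by simp
    moreover have "0 < (1/3::real) ^ (m + nat \<bar>j\<bar>)" by simp
    ultimately show False by linarith
  qed
next
  assume "x = y"
  then have "point_dist A x y \<le> 0" by (intro point_dist_leI) (simp add: sym_dist_same)
  with point_dist_nonneg[of A x y] show "point_dist A x y = 0" by simp
qed

lemma Metric_space_point_dist: "hub_isolated A \<Longrightarrow> Metric_space M (point_dist A)"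
  by unfold_locales
    (auto simp: point_dist_nonneg point_dist_eq_0_iff point_dist_triangle intro: point_dist_commute)

lemma shift_funpow: "(shift ^^ t) x m j = x m (j + int t)"
  by (induction t arbitrary: j) (auto simp: shift_def algebra_simps)

lemma sym_dist_translate:
  "sym_dist A (\<lambda>t. x (t + k)) (\<lambda>t. y (t + k)) j = sym_dist A x y (j + k)"
proof -
  have "tail_gap s (\<lambda>t. x (t + k)) (\<lambda>t. y (t + k)) j = tail_gap s x y (j + k)" for s
    by (simp add: tail_gap_def algebra_simps)
  then show ?thesis by (simp add: sym_dist_def)
qed

lemma sym_dist_shift:
  "sym_dist A ((shift ^^ t) x m) ((shift ^^ t) y m) j = sym_dist A (x m) (y m) (j + int t)"
proof -
  have "(shift ^^ t) x m = (\<lambda>i. x m (i + int t))" for x by (rule ext) (rule shift_funpow)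
  then show ?thesis by (simp add: sym_dist_translate)
qed

lemma point_dist_shift_le: "point_dist A (shift x) (shift y) \<le> 3 * point_dist A x y"
proof (rule point_dist_leI)
  fix m j
  have "(1/3::real) ^ (m + nat \<bar>j\<bar>) = 3 * (1/3) ^ Suc (m + nat \<bar>j\<bar>)" by simp
  also have "\<dots> \<le> 3 * (1/3) ^ (m + nat \<bar>j + 1\<bar>)"
    by (intro mult_left_mono power_decreasing) auto
  finally have *: "(1/3::real) ^ (m + nat \<bar>j\<bar>) \<le> 3 * (1/3) ^ (m + nat \<bar>j + 1\<bar>)" .
  have "(1/3) ^ (m + nat \<bar>j\<bar>) * sym_dist A (shift x m) (shift y m) j
      = (1/3) ^ (m + nat \<bar>j\<bar>) * sym_dist A (x m) (y m) (j + 1)"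
    using sym_dist_shift[of A 1 x m y j] by simp
  also have "\<dots> \<le> (3 * (1/3) ^ (m + nat \<bar>j + 1\<bar>)) * sym_dist A (x m) (y m) (j + 1)"
    by (intro mult_right_mono * sym_dist_nonneg)
  also have "\<dots> \<le> 3 * point_dist A x y" using point_dist_ge[of m "j+1" A x y] by simp
  finally show "(1/3) ^ (m + nat \<bar>j\<bar>) * sym_dist A (shift x m) (shift y m) j \<le> 3 * point_dist A x y" .
qed

section \<open>Blocks, tracks and compactness\<close>

definition symbols :: "nat set" where
  "symbols = {v. v = 0 \<or> side v \<noteq> 0 \<and> dig v < 6}"

text \<open>Even factorials; the odd factorials between them are time scales at which whole blocks are negligible.\<close>

definition levels :: "nat set" where
  "levels = range (\<lambda>k. fact (2 * k))"

text \<open>A block of level \<open>a\<close> around \<open>c\<close>: \<open>12 a\<close> left digits, a gap of stars of radius \<open>a\<close>, and the mirror image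
of the left digits as right digits. The flag \<open>h\<close> says whether the hub may occur. The gap grows
with the level, so that no limit of blocks of growing level shows both sides.\<close>

definition block :: "bool \<Rightarrow> nat \<Rightarrow> int \<Rightarrow> (int \<Rightarrow> nat) set" where
  "block h a c =
     {x. (\<forall>t. side (x t) =
            (if c - 13 * int a \<le> t \<and> t < c - int a then 1
             else if c + int a < t \<and> t \<le> c + 13 * int a then 2 else 0)) \<and>
         (\<forall>j. int a < j \<and> j \<le> 13 * int a \<longrightarrow> x (c + j) = Suc (x (c - j))) \<and>
         (h \<or> (\<forall>t. dig (x t) \<noteq> 5))}"

text \<open>A track with digits on both sides is a block; all others are intervals of digits of one side,
with hubs allowed regardless of \<open>h\<close>. These intervals include all limits of blocks of growing level.\<close>

definition tracks :: "bool \<Rightarrow> (int \<Rightarrow> nat) set" where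
  "tracks h =
     {x. (\<forall>t. x t \<in> symbols) \<and>
         (\<forall>i j k. i \<le> j \<and> j \<le> k \<and> side (x i) = side (x k) \<and> side (x i) \<noteq> 0 \<longrightarrow> side (x j) = side (x i)) \<and>
         (\<forall>i j. side (x i) = 1 \<and> side (x j) = 2 \<longrightarrow> (\<exists>a\<in>levels. \<exists>c. x \<in> block h a c))}"

definition points :: "bool \<Rightarrow> point set" where
  "points h = {x. \<forall>m. x m \<in> tracks h}"

definition system :: "digit_graph \<Rightarrow> bool \<Rightarrow> point metric" where
  "system A h = metric (points h, point_dist A)"

lemma finite_symbols: "finite symbols"
proof (rule finite_subset)
  show "symbols \<subseteq> {..<18}" by (auto simp: symbols_def)
qed auto

lemma mspace_system: "hub_isolated A \<Longrightarrow> mspace (system A h) = points h"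
  and mdist_system: "hub_isolated A \<Longrightarrow> mdist (system A h) = point_dist A"
  using Metric_space_point_dist[of A "points h"]
  by (simp_all add: system_def Metric_space.mspace_metric Metric_space.mdist_metric)

lemma open_coord:
  fixes P :: "nat \<Rightarrow> bool"
  shows "open {x :: int \<Rightarrow> nat. P (x t)}"
proof -
  have "open ((\<lambda>x :: int \<Rightarrow> nat. x t) -` {v. P v})"
    by (intro open_vimage open_discrete) simp
  then show ?thesis by (simp add: vimage_def)
qed

lemma closed_coord:
  fixes P :: "nat \<Rightarrow> bool"
  shows "closed {x :: int \<Rightarrow> nat. P (x t)}"
  using open_coord[of "\<lambda>v. \<not> P v" t] by (simp add: closed_def Compl_eq)

lemma closed_coord2:
  fixes P :: "nat \<Rightarrow> nat \<Rightarrow> bool"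
  shows "closed {x :: int \<Rightarrow> nat. P (x s) (x t)}"
proof -
  have "{x :: int \<Rightarrow> nat. P (x s) (x t)} = {x. \<forall>v. x s = v \<longrightarrow> P v (x t)}" by auto
  also have "closed \<dots>"
    by (intro closed_Collect_all closed_Collect_imp open_coord closed_coord)
  finally show ?thesis .
qed

lemma closed_coord3:
  fixes P :: "nat \<Rightarrow> nat \<Rightarrow> nat \<Rightarrow> bool"
  shows "closed {x :: int \<Rightarrow> nat. P (x r) (x s) (x t)}"
proof -
  have "{x :: int \<Rightarrow> nat. P (x r) (x s) (x t)} = {x. \<forall>v. x r = v \<longrightarrow> P v (x s) (x t)}" by auto
  also have "closed \<dots>"
    by (intro closed_Collect_all closed_Collect_imp open_coord closed_coord2)
  finally show ?thesis .
qed

lemma closed_block: "closed (block h a c)"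
proof -
  have "block h a c =
     {x. \<forall>t. side (x t) =
            (if c - 13 * int a \<le> t \<and> t < c - int a then 1
             else if c + int a < t \<and> t \<le> c + 13 * int a then 2 else 0)} \<inter>
     {x. \<forall>j. int a < j \<and> j \<le> 13 * int a \<longrightarrow> x (c + j) = Suc (x (c - j))} \<inter>
     {x. \<forall>t. h \<or> dig (x t) \<noteq> 5}"
    by (auto simp: block_def)
  also have "closed \<dots>"
    by (intro closed_Int closed_Collect_all closed_Collect_imp closed_coord2 closed_coord) auto
  finally show ?thesis .
qed

lemma block_side:
  assumes "x \<in> block h a c"
  shows "side (x t) = (if c - 13 * int a \<le> t \<and> t < c - int a then 1
             else if c + int a < t \<and> t \<le> c + 13 * int a then 2 else 0)"
  using assms by (simp add: block_def)

lemma block_left_iff: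
  assumes "x \<in> block h a c"
  shows "side (x t) = 1 \<longleftrightarrow> c - 13 * int a \<le> t \<and> t < c - int a"
  unfolding block_side[OF assms] by simp

lemma block_right_iff:
  assumes "x \<in> block h a c"
  shows "side (x t) = 2 \<longleftrightarrow> c + int a < t \<and> t \<le> c + 13 * int a"
  unfolding block_side[OF assms] by simp

lemma block_mirror:
  assumes "x \<in> block h a c" "int a < j" "j \<le> 13 * int a"
  shows "x (c + j) = Suc (x (c - j))"
  using assms by (simp add: block_def)

lemma tracks_symbol: "x \<in> tracks h \<Longrightarrow> x t \<in> symbols"
  by (simp add: tracks_def)

lemma tracks_dig:
  assumes "x \<in> tracks h" shows "dig (x t) < 6"
  using tracks_symbol[OF assms, of t] by (auto simp: symbols_def)

lemma tracks_convex:
  assumes "x \<in> tracks h" "i \<le> j" "j \<le> k" "side (x i) = side (x k)" "side (x i) \<noteq> 0"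
  shows "side (x j) = side (x i)"
  using assms(1) unfolding tracks_def mem_Collect_eq using assms(2-) by blast

lemma tracks_block:
  assumes "x \<in> tracks h" "side (x i) = 1" "side (x j) = 2"
  obtains a c where "a \<in> levels" "x \<in> block h a c"
  using assms(1) unfolding tracks_def mem_Collect_eq using assms(2-) by blast

lemma tracksI_one_sided:
  assumes "\<And>t. x t \<in> symbols"
    and "\<And>i j k. i \<le> j \<Longrightarrow> j \<le> k \<Longrightarrow> side (x i) = side (x k) \<Longrightarrow> side (x i) \<noteq> 0 \<Longrightarrow> side (x j) = side (x i)"
    and "\<And>i j. side (x i) = 1 \<Longrightarrow> side (x j) = 2 \<Longrightarrow> False"
  shows "x \<in> tracks h"
  unfolding tracks_def mem_Collect_eq using assms by blast

lemma zero_track: "(\<lambda>_. 0) \<in> tracks h"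
  by (rule tracksI_one_sided) (auto simp: symbols_def)

lemma tracksI_block:
  assumes "a \<in> levels" "x \<in> block h a c" "\<And>t. x t \<in> symbols"
  shows "x \<in> tracks h"
proof -
  have "side (x j) = side (x i)" if "i \<le> j" "j \<le> k" "side (x i) = side (x k)" "side (x i) \<noteq> 0" for i j k
  proof (cases "side (x i) = 1")
    case True
    then have "side (x k) = 1" using that by simp
    then have "side (x j) = 1"
      using True that(1,2) block_left_iff[OF assms(2), of i] block_left_iff[OF assms(2), of j]
        block_left_iff[OF assms(2), of k] by simp
    then show ?thesis using True by simp
  next
    case False
    moreover have "side (x i) < 3" by simp
    ultimately have 2: "side (x i) = 2" using that(4) by linarith
    then have "side (x k) = 2" using that by simp
    then have "side (x j) = 2"
      using 2 that(1,2) block_right_iff[OF assms(2), of i] block_right_iff[OF assms(2), of j]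
        block_right_iff[OF assms(2), of k] by simp
    then show ?thesis using 2 by simp
  qed
  then show ?thesis
    unfolding tracks_def mem_Collect_eq using assms by blast
qed

text \<open>Two opposite-sided positions of a block leave only finitely many choices for its level and its centre.\<close>

lemma closed_sided_blocks:
  "closed {x. side (x i) = 1 \<and> side (x j) = 2 \<longrightarrow> (\<exists>a\<in>levels. \<exists>c. x \<in> block h a c)}"
proof -
  \<comment> \<open>A left digit at \<open>i\<close> and a right digit at \<open>j\<close> enclose the gap.\<close>
  let ?B = "\<Union>a\<in>levels \<inter> {..nat (j - i)}. \<Union>c\<in>{i..j}. block h a c"
  have "{x. side (x i) = 1 \<and> side (x j) = 2 \<longrightarrow> (\<exists>a\<in>levels. \<exists>c. x \<in> block h a c)}
      = {x. \<not> (side (x i) = 1)} \<union> {x. \<not> (side (x j) = 2)} \<union> ?B" (is "?L = ?R")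
  proof
    show "?L \<subseteq> ?R"
    proof
      fix x assume x: "x \<in> ?L"
      show "x \<in> ?R"
      proof (cases "side (x i) = 1 \<and> side (x j) = 2")
        case True
        then obtain a c where ac: "a \<in> levels" "x \<in> block h a c" using x by blast
        have "i < c - int a" "c + int a < j"
          using True block_left_iff[OF ac(2), of i] block_right_iff[OF ac(2), of j] by simp_all
        then have "a \<in> levels \<inter> {..nat (j - i)}" "c \<in> {i..j}" using ac(1) by auto
        then show ?thesis using ac(2) by blast
      next
        case False
        then show ?thesis by blast
      qed
    qed
    show "?R \<subseteq> ?L" by blast
  qed
  also have "closed \<dots>"
    by (intro closed_Un closed_coord closed_UN closed_block ballI) auto
  finally show ?thesis .
qed

lemma compact_PiE_UNIV:
  fixes S :: "'b :: topological_space set"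
  assumes "compact S" shows "compact (PiE UNIV (\<lambda>_ :: 'i. S))"
proof -
  have "compactin (product_topology (\<lambda>_ :: 'i. euclidean) UNIV) (PiE UNIV (\<lambda>_. S))"
    using assms by (subst compactin_PiE) simp
  then show ?thesis
    using compactin_euclidean_iff[where S="PiE UNIV (\<lambda>_ :: 'i. S)"]
    unfolding euclidean_product_topology by blast
qed

lemma compact_tracks: "compact (tracks h)"
proof -
  have "tracks h = (PiE UNIV (\<lambda>_. symbols)) \<inter>
     ({x. \<forall>i j k. i \<le> j \<and> j \<le> k \<and> side (x i) = side (x k) \<and> side (x i) \<noteq> 0 \<longrightarrow> side (x j) = side (x i)} \<inter>
      {x. \<forall>i j. side (x i) = 1 \<and> side (x j) = 2 \<longrightarrow> (\<exists>a\<in>levels. \<exists>c. x \<in> block h a c)})"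
    unfolding tracks_def PiE_UNIV_domain by blast
  also have "compact \<dots>"
  proof (rule compact_Int_closed)
    show "compact (PiE UNIV (\<lambda>_::int. symbols))"
      by (intro compact_PiE_UNIV finite_imp_compact finite_symbols)
    show "closed ({x :: int \<Rightarrow> nat. \<forall>i j k. i \<le> j \<and> j \<le> k \<and> side (x i) = side (x k) \<and> side (x i) \<noteq> 0 \<longrightarrow> side (x j) = side (x i)} \<inter>
      {x. \<forall>i j. side (x i) = 1 \<and> side (x j) = 2 \<longrightarrow> (\<exists>a\<in>levels. \<exists>c. x \<in> block h a c)})"
    proof (intro closed_Int closed_Collect_all)
      show "closed {x :: int \<Rightarrow> nat. i \<le> j \<and> j \<le> k \<and> side (x i) = side (x k) \<and> side (x i) \<noteq> 0 \<longrightarrow> side (x j) = side (x i)}"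
        for i j k
        by (rule closed_coord3[where P="\<lambda>u v w. i \<le> j \<and> j \<le> k \<and> side u = side w \<and> side u \<noteq> 0 \<longrightarrow> side v = side u"])
    qed (rule closed_sided_blocks)
  qed
  finally show ?thesis .
qed

lemma compact_points: "compact (points h)"
proof -
  have "points h = PiE UNIV (\<lambda>_. tracks h)" by (auto simp: points_def PiE_UNIV_domain)
  also have "compact \<dots>"
    by (intro compact_PiE_UNIV compact_tracks)
  finally show ?thesis .
qed

lemma open_coords:
  fixes x :: point
  shows "open {y :: point. \<forall>m\<in>{..N}. \<forall>j\<in>{- int N..int N}. y m j = x m j}"
proof -
  have "open {y :: point. y m j = x m j}" for m j
  proof -
    have "open ((\<lambda>y :: point. y m) -` {z. z j = x m j})"
      by (intro open_vimage open_coord) simp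
    then show ?thesis by (simp add: vimage_def)
  qed
  then have "open (\<Inter>m\<in>{..N}. \<Inter>j\<in>{- int N..int N}. {y :: point. y m j = x m j})"
    by (intro open_INT) auto
  also have "(\<Inter>m\<in>{..N}. \<Inter>j\<in>{- int N..int N}. {y :: point. y m j = x m j})
      = {y. \<forall>m\<in>{..N}. \<forall>j\<in>{- int N..int N}. y m j = x m j}" by auto
  finally show ?thesis .
qed

lemma point_dist_le_of_agree:
  assumes "\<forall>m\<in>{..N}. \<forall>j\<in>{- int N..int N}. y m j = x m j"
  shows "point_dist A x y \<le> (1/3) ^ N"
proof (rule point_dist_leI)
  fix m j
  show "(1/3) ^ (m + nat \<bar>j\<bar>) * sym_dist A (x m) (y m) j \<le> (1/3) ^ N"
  proof (cases "m \<le> N \<and> \<bar>j\<bar> \<le> int N")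
    case True
    then have "y m j = x m j" by (intro assms[rule_format]) auto
    then show ?thesis by (simp add: sym_dist_same)
  next
    case False
    then have "(1/3::real) ^ (m + nat \<bar>j\<bar>) \<le> (1/3) ^ N" by (intro power_decreasing) auto
    with dist_term_le[of m j A x y] show ?thesis by linarith
  qed
qed

text \<open>The product topology is compact, so a continuous identity map onto the metric topology transfers compactness.\<close>

lemma point_dist_continuous_id:
  assumes A: "hub_isolated A"
  shows "continuous_map (top_of_set (points h)) (mtopology_of (system A h)) (\<lambda>x. x)"
proof -
  interpret Metric_space "points h" "point_dist A" by (rule Metric_space_point_dist[OF A])
  have "continuous_map (top_of_set (points h)) mtopology (\<lambda>x. x)"
    unfolding continuous_map_to_metric
  proof (intro ballI allI impI)
    fix x :: point and \<epsilon> :: real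
    assume x: "x \<in> topspace (top_of_set (points h))" and \<epsilon>: "\<epsilon> > 0"
    obtain N where N: "(1/3::real) ^ N < \<epsilon>" using real_arch_pow_inv[OF \<epsilon>, of "1/3"] by auto
    let ?U = "points h \<inter> {y :: point. \<forall>m\<in>{..N}. \<forall>j\<in>{- int N..int N}. y m j = x m j}"
    have "openin (top_of_set (points h)) ?U" by (rule openin_open_Int[OF open_coords])
    moreover have "x \<in> ?U" using x by auto
    moreover have "\<forall>y\<in>?U. y \<in> mball x \<epsilon>"
      using x point_dist_le_of_agree[of N _ x A] N by (auto intro: le_less_trans)
    ultimately show "\<exists>U. openin (top_of_set (points h)) U \<and> x \<in> U \<and> (\<forall>y\<in>U. y \<in> mball x \<epsilon>)" by blast
  qed
  then show ?thesis by (simp add: mtopology_of_def mspace_system[OF A] mdist_system[OF A])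
qed

lemma compact_system:
  assumes A: "hub_isolated A"
  shows "compact_space (mtopology_of (system A h))"
proof -
  have "compactin (mtopology_of (system A h)) ((\<lambda>x. x) ` points h)"
    by (rule image_compactin[OF _ point_dist_continuous_id[OF A]])
      (use compact_points in \<open>simp add: compactin_subtopology\<close>)
  then show ?thesis by (simp add: compact_space_def mspace_system[OF A])
qed

lemma block_translate:
  assumes "x \<in> block h a c" shows "(\<lambda>t. x (t + k)) \<in> block h a (c - k)"
proof -
  have "x (c - k + j + k) = x (c + j)" "x (c - k - j + k) = x (c - j)" for j
    by (simp_all add: algebra_simps)
  then show ?thesis using assms by (auto simp: block_def)
qed

lemma tracks_translate:
  assumes "x \<in> tracks h" shows "(\<lambda>t. x (t + k)) \<in> tracks h"
proof -
  have "side (x (j + k)) = side (x (i + k))"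
    if "i \<le> j" "j \<le> l" "side (x (i + k)) = side (x (l + k))" "side (x (i + k)) \<noteq> 0" for i j l
    using assms that unfolding tracks_def mem_Collect_eq by (meson add_right_mono)
  moreover have "\<exists>a\<in>levels. \<exists>c. (\<lambda>t. x (t + k)) \<in> block h a c"
    if "side (x (i + k)) = 1" "side (x (j + k)) = 2" for i j
    using assms that block_translate[of x h _ _ k] unfolding tracks_def mem_Collect_eq by meson
  ultimately show ?thesis using assms unfolding tracks_def mem_Collect_eq by blast
qed

lemma shift_in_points: "x \<in> points h \<Longrightarrow> shift x \<in> points h"
  by (auto simp: points_def shift_def intro: tracks_translate)

lemma shift_image: "shift ` points h = points h"
proof
  show "points h \<subseteq> shift ` points h"
  proof
    fix x assume "x \<in> points h"
    then have "(\<lambda>m t. x m (t + (- 1))) \<in> points h" "x = shift (\<lambda>m t. x m (t + (- 1)))"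
      using tracks_translate[of _ h "-1"] by (auto simp: points_def shift_def)
    then show "x \<in> shift ` points h" by blast
  qed
qed (auto intro: shift_in_points)

lemma inj_shift: "inj shift"
proof (rule injI, intro ext)
  fix x y m t assume "shift x = shift y"
  then have "shift x m (t - 1) = shift y m (t - 1)" by simp
  then show "x m t = y m t" by (simp add: shift_def)
qed

lemma compact_homeo_system_shift:
  assumes A: "hub_isolated A"
  shows "compact_homeo_system (system A h) shift"
proof -
  interpret Metric_space "points h" "point_dist A" by (rule Metric_space_point_dist[OF A])
  have mt: "mtopology_of (system A h) = mtopology"
    by (simp add: mtopology_of_def mspace_system[OF A] mdist_system[OF A])
  have "continuous_map mtopology mtopology shift"
    unfolding continuous_map_to_metric
  proof (intro ballI allI impI)
    fix x \<epsilon> assume x: "x \<in> topspace mtopology" and \<epsilon>: "(\<epsilon>::real) > 0"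
    have "\<forall>y\<in>mball x (\<epsilon>/3). shift y \<in> mball (shift x) \<epsilon>"
    proof
      fix y assume y: "y \<in> mball x (\<epsilon>/3)"
      then show "shift y \<in> mball (shift x) \<epsilon>"
        using point_dist_shift_le[of A x y] by (auto intro: shift_in_points)
    qed
    moreover have "x \<in> mball x (\<epsilon>/3)" using x \<epsilon> by simp
    ultimately show "\<exists>U. openin mtopology U \<and> x \<in> U \<and> (\<forall>y\<in>U. shift y \<in> mball (shift x) \<epsilon>)"
      using openin_mball by blast
  qed
  then have "homeomorphic_map mtopology mtopology shift"
    using compact_system[OF A, of h] Hausdorff_space_mtopology inj_shift
    by (intro continuous_imp_homeomorphic_map) (auto simp: mt shift_image intro: inj_on_subset)
  then show ?thesis
    using compact_system[OF A, of h] by (simp add: compact_homeo_system_def mt)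
qed

section \<open>Separated and spanning sets\<close>

lemma card_le_fibres:
  assumes "finite S" "finite C" "\<kappa> ` S \<subseteq> C" and B: "\<And>c. c \<in> C \<Longrightarrow> card {x \<in> S. \<kappa> x = c} \<le> B"
  shows "card S \<le> card C * B"
proof -
  have "(\<Union>c\<in>C. {x \<in> S. \<kappa> x = c}) = S" using assms(3) by auto
  with card_UN_le[OF assms(2), of "\<lambda>c. {x \<in> S. \<kappa> x = c}"]
  have "card S \<le> (\<Sum>c\<in>C. card {x \<in> S. \<kappa> x = c})" by simp
  also have "\<dots> \<le> (\<Sum>c\<in>C. B)" by (intro sum_mono B)
  finally show ?thesis by simp
qed

text \<open>A bound on the sizes of separated sets makes the greatest element in the definition of \<open>sep_num\<close> exist.\<close>

lemma sep_num_attained: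
  assumes "\<And>S. S \<subseteq> X \<Longrightarrow> finite S \<Longrightarrow> separated_set \<epsilon> \<mu> S \<Longrightarrow> card S \<le> B"
  obtains S where "S \<subseteq> X" "finite S" "separated_set \<epsilon> \<mu> S" "card S = sep_num X \<epsilon> \<mu>"
proof -
  let ?P = "\<lambda>n. \<exists>S. S \<subseteq> X \<and> finite S \<and> separated_set \<epsilon> \<mu> S \<and> card S = n"
  have "?P 0" by (rule exI[of _ "{}"]) (simp add: separated_set_def)
  moreover have "\<And>n. ?P n \<Longrightarrow> n \<le> B" using assms by blast
  ultimately have "?P (GREATEST n. ?P n)" by (rule GreatestI_nat)
  then show ?thesis using that unfolding sep_num_def[symmetric] by blast
qed

lemma sep_num_le:
  assumes "\<And>S. S \<subseteq> X \<Longrightarrow> finite S \<Longrightarrow> separated_set \<epsilon> \<mu> S \<Longrightarrow> card S \<le> B"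
  shows "sep_num X \<epsilon> \<mu> \<le> B"
proof -
  obtain S where "S \<subseteq> X" "finite S" "separated_set \<epsilon> \<mu> S" "card S = sep_num X \<epsilon> \<mu>"
    by (rule sep_num_attained[OF assms])
  then show ?thesis using assms[of S] by simp
qed

lemma card_le_sep_num:
  assumes "\<And>S. S \<subseteq> X \<Longrightarrow> finite S \<Longrightarrow> separated_set \<epsilon> \<mu> S \<Longrightarrow> card S \<le> B"
    and "S \<subseteq> X" "finite S" "separated_set \<epsilon> \<mu> S"
  shows "card S \<le> sep_num X \<epsilon> \<mu>"
  unfolding sep_num_def
proof (rule Greatest_le_nat[of _ _ B])
  show "\<exists>S'. S' \<subseteq> X \<and> finite S' \<and> separated_set \<epsilon> \<mu> S' \<and> card S' = card S"
    using assms(2-4) by (intro exI[of _ S]) simp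
  show "n \<le> B" if "\<exists>S. S \<subseteq> X \<and> finite S \<and> separated_set \<epsilon> \<mu> S \<and> card S = n" for n
    using that assms(1) by auto
qed

lemma span_num_le: "S \<subseteq> X \<Longrightarrow> finite S \<Longrightarrow> spanning_set X \<epsilon> \<mu> S \<Longrightarrow> span_num X \<epsilon> \<mu> \<le> card S"
  unfolding span_num_def by (rule Least_le) blast

text \<open>One representative of each code class, moved by \<open>s\<close>, is close to the whole class.\<close>

lemma span_num_le_code:
  assumes C: "finite C" "\<kappa> ` X \<subseteq> C" and s: "\<And>x. x \<in> X \<Longrightarrow> s x \<in> X"
    and close: "\<And>x y. x \<in> X \<Longrightarrow> y \<in> X \<Longrightarrow> \<kappa> x = \<kappa> y \<Longrightarrow> \<mu> (s x) y < \<epsilon>"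
  shows "span_num X \<epsilon> \<mu> \<le> card C"
proof -
  define r where "r = inv_into X \<kappa>"
  let ?S = "(\<lambda>c. s (r c)) ` \<kappa> ` X"
  have r: "r c \<in> X" "\<kappa> (r c) = c" if "c \<in> \<kappa> ` X" for c
    using that by (auto simp: r_def intro: inv_into_into f_inv_into_f)
  have fin: "finite (\<kappa> ` X)" using C finite_subset by blast
  have "spanning_set X \<epsilon> \<mu> ?S"
    unfolding spanning_set_def using r by (auto intro!: close)
  then have "span_num X \<epsilon> \<mu> \<le> card ?S"
    using r s fin by (intro span_num_le) auto
  also have "\<dots> \<le> card (\<kappa> ` X)" by (rule card_image_le[OF fin])
  also have "\<dots> \<le> card C" by (rule card_mono) (use C in auto)
  finally show ?thesis .
qed

text \<open>Every point of \<open>P\<close> needs a spanning point of its own.\<close>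

lemma card_le_span_num:
  assumes ex: "S0 \<subseteq> X" "finite S0" "spanning_set X \<epsilon> \<mu> S0"
    and P: "P \<subseteq> X"
    and uniq: "\<And>s p p'. s \<in> X \<Longrightarrow> p \<in> P \<Longrightarrow> p' \<in> P \<Longrightarrow> \<mu> s p < \<epsilon> \<Longrightarrow> \<mu> s p' < \<epsilon> \<Longrightarrow> p = p'"
  shows "card P \<le> span_num X \<epsilon> \<mu>"
proof -
  let ?P = "\<lambda>n. \<exists>S. S \<subseteq> X \<and> finite S \<and> spanning_set X \<epsilon> \<mu> S \<and> card S = n"
  have "?P (LEAST n. ?P n)" by (rule LeastI_ex) (use ex in blast)
  then obtain S where S: "S \<subseteq> X" "finite S" "spanning_set X \<epsilon> \<mu> S" "card S = span_num X \<epsilon> \<mu>"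
    unfolding span_num_def by blast
  have "\<forall>p\<in>P. \<exists>s\<in>S. \<mu> s p < \<epsilon>" using S(3) P by (auto simp: spanning_set_def)
  then obtain f where f: "\<And>p. p \<in> P \<Longrightarrow> f p \<in> S \<and> \<mu> (f p) p < \<epsilon>" by metis
  have "inj_on f P"
    by (rule inj_onI) (metis f uniq S(1) subsetD)
  then have "card P \<le> card S" using f S(2) by (intro card_inj_on_le) auto
  with S(4) show ?thesis by simp
qed

text \<open>A point at distance at least \<open>\<epsilon>\<close> from a largest separated set could be added to it.\<close>

lemma maximal_separated_spans:
  assumes bound: "\<And>S. S \<subseteq> X \<Longrightarrow> finite S \<Longrightarrow> separated_set \<epsilon> \<mu> S \<Longrightarrow> card S \<le> B"
    and refl: "\<And>x. x \<in> X \<Longrightarrow> \<mu> x x < \<epsilon>" and sym: "\<And>x y. x \<in> X \<Longrightarrow> y \<in> X \<Longrightarrow> \<mu> x y = \<mu> y x"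
  shows "\<exists>S\<subseteq>X. finite S \<and> spanning_set X \<epsilon> \<mu> S \<and> card S = sep_num X \<epsilon> \<mu>"
proof -
  obtain S where S: "S \<subseteq> X" "finite S" "separated_set \<epsilon> \<mu> S" "card S = sep_num X \<epsilon> \<mu>"
    by (rule sep_num_attained[OF bound])
  have "spanning_set X \<epsilon> \<mu> S"
    unfolding spanning_set_def
  proof (rule ballI, rule ccontr)
    fix x assume x: "x \<in> X" and far: "\<not> (\<exists>s\<in>S. \<mu> s x < \<epsilon>)"
    then have "x \<notin> S" using refl by blast
    have "separated_set \<epsilon> \<mu> (insert x S)"
      unfolding separated_set_def
    proof (intro ballI impI)
      fix y z assume yz: "y \<in> insert x S" "z \<in> insert x S" "y \<noteq> z"
      have ge: "\<epsilon> \<le> \<mu> s x" if "s \<in> S" for s using far that by (simp add: not_less)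
      consider "y \<in> S" "z \<in> S" | "y = x" "z \<in> S" | "y \<in> S" "z = x" using yz by auto
      then show "\<epsilon> \<le> \<mu> y z"
      proof cases
        case 1
        then show ?thesis using S(3) yz(3) by (simp add: separated_set_def)
      next
        case 2
        then show ?thesis using ge[of z] sym[OF x, of z] S(1) by auto
      next
        case 3
        then show ?thesis using ge by simp
      qed
    qed
    then have "card (insert x S) \<le> sep_num X \<epsilon> \<mu>"
      using S x by (intro card_le_sep_num[OF bound]) auto
    with \<open>x \<notin> S\<close> S show False by simp
  qed
  with S show ?thesis by blast
qed

section \<open>Counting words\<close>

text \<open>Forgets the digits from \<open>q\<close> on by merging them with digit 0: \<open>q = 6\<close> keeps the symbol, \<open>q = 5\<close>
hides the hub, and \<open>q = 1\<close> leaves only the side.\<close>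

definition reduce :: "nat \<Rightarrow> nat \<Rightarrow> nat" where
  "reduce q v = side v + 3 * (if dig v < q then dig v else 0)"

definition words :: "bool \<Rightarrow> nat \<Rightarrow> int set \<Rightarrow> (int \<Rightarrow> nat) set" where
  "words h q I = (\<lambda>x. restrict (\<lambda>t. reduce q (x t)) I) ` tracks h"

lemma side_reduce: "side (reduce q v) = side v"
  by (simp add: reduce_def)

lemma reduce_6: "v \<in> symbols \<Longrightarrow> reduce 6 v = v"
  by (auto simp: reduce_def symbols_def)

lemma convex_in_window:
  fixes u v :: int and P :: "int \<Rightarrow> bool"
  assumes uv: "u \<le> v" and P: "\<And>i j k. i \<le> j \<Longrightarrow> j \<le> k \<Longrightarrow> P i \<Longrightarrow> P k \<Longrightarrow> P j"
  obtains p q where "p \<in> {u..v}" "q \<in> {u..v}" "\<And>t. t \<in> {u..<v} \<Longrightarrow> P t \<longleftrightarrow> p \<le> t \<and> t < q"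
proof (cases "\<exists>t\<in>{u..<v}. P t")
  case False
  show ?thesis by (rule that[of u u]) (use False uv in auto)
next
  case True
  let ?S = "{t \<in> {u..<v}. P t}"
  have "finite ?S" by (rule finite_subset[of _ "{u..<v}"]) auto
  moreover have "?S \<noteq> {}" using True by auto
  ultimately have S: "finite ?S" "?S \<noteq> {}" .
  define p q where "p = Min ?S" and "q = Max ?S"
  have p: "p \<in> ?S" and q: "q \<in> ?S" unfolding p_def q_def by (rule Min_in[OF S], rule Max_in[OF S])
  show ?thesis
  proof (rule that[of p "q + 1"])
    fix t assume t: "t \<in> {u..<v}"
    show "P t \<longleftrightarrow> p \<le> t \<and> t < q + 1"
    proof
      assume "P t"
      then have "t \<in> ?S" using t by simp
      then have "p \<le> t" "t \<le> q" unfolding p_def q_def using S by auto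
      then show "p \<le> t \<and> t < q + 1" by simp
    next
      assume "p \<le> t \<and> t < q + 1"
      then show "P t" using P[of p t q] p q by simp
    qed
  qed (use p q in auto)
qed

text \<open>The left and the right positions of a track in a window are two intervals. Their four endpoints
give the polynomial factor, and one digit per position gives the exponential one.\<close>

lemma card_words:
  fixes u v :: int
  assumes uv: "u \<le> v" and q: "0 < q"
  shows "finite (words h q {u..<v})" and "card (words h q {u..<v}) \<le> (nat (v - u) + 1) ^ 4 * q ^ nat (v - u)"
proof -
  define decode where "decode = (\<lambda>((l, l', r, r'), g).
     restrict (\<lambda>t. if l \<le> t \<and> t < l' then 3 * g t + 1 else if r \<le> t \<and> t < r' then 3 * g t + 2 else (0::nat)) {u..<v})"
  let ?I = "{u..v}"
  let ?C = "(?I \<times> ?I \<times> ?I \<times> ?I) \<times> ({u..<v} \<rightarrow>\<^sub>E {..<q})"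
  have sub: "words h q {u..<v} \<subseteq> decode ` ?C"
  proof
    fix w assume "w \<in> words h q {u..<v}"
    then obtain x where x: "x \<in> tracks h" and w: "w = restrict (\<lambda>t. reduce q (x t)) {u..<v}"
      by (auto simp: words_def)
    obtain l l' where l: "l \<in> ?I" "l' \<in> ?I" "\<And>t. t \<in> {u..<v} \<Longrightarrow> side (x t) = 1 \<longleftrightarrow> l \<le> t \<and> t < l'"
      by (rule convex_in_window[OF uv, of "\<lambda>t. side (x t) = 1"]) (use tracks_convex[OF x] in auto)
    obtain r r' where r: "r \<in> ?I" "r' \<in> ?I" "\<And>t. t \<in> {u..<v} \<Longrightarrow> side (x t) = 2 \<longleftrightarrow> r \<le> t \<and> t < r'"
      by (rule convex_in_window[OF uv, of "\<lambda>t. side (x t) = 2"]) (use tracks_convex[OF x] in auto)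
    define g where "g = restrict (\<lambda>t. if dig (x t) < q then dig (x t) else 0) {u..<v}"
    have "w t = decode ((l, l', r, r'), g) t" for t
    proof (cases "t \<in> {u..<v}")
      case True
      have "reduce q (x t) = side (x t) + 3 * g t" using True by (simp add: reduce_def g_def)
      moreover have "side (x t) = 0 \<Longrightarrow> reduce q (x t) = 0"
        using tracks_symbol[OF x, of t] by (auto simp: symbols_def reduce_def)
      moreover have "side (x t) = 0 \<or> side (x t) = 1 \<or> side (x t) = 2" by linarith
      ultimately show ?thesis
        using l(3)[OF True] r(3)[OF True] True by (auto simp: w decode_def)
    qed (auto simp: w decode_def)
    then have "w = decode ((l, l', r, r'), g)" by (rule ext)
    moreover have "((l, l', r, r'), g) \<in> ?C" using l(1,2) r(1,2) q by (auto simp: g_def)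
    ultimately show "w \<in> decode ` ?C" by blast
  qed
  have fin: "finite ?C" by (intro finite_cartesian_product finite_PiE) auto
  then show "finite (words h q {u..<v})" using sub finite_surj by blast
  have "card (words h q {u..<v}) \<le> card ?C" by (rule surj_card_le[OF fin sub])
  also have "\<dots> = (nat (v - u) + 1) ^ 4 * q ^ nat (v - u)"
  proof -
    have "card ?I = nat (v - u) + 1" using uv by simp
    then show ?thesis by (simp only: card_cartesian_product card_PiE finite_atLeastLessThan_int) 
      (simp add: power4_eq_xxxx)
  qed
  finally show "card (words h q {u..<v}) \<le> (nat (v - u) + 1) ^ 4 * q ^ nat (v - u)" .
qed

definition two_sided :: "nat \<Rightarrow> (int \<Rightarrow> nat) \<Rightarrow> bool" where
  "two_sided T x \<longleftrightarrow> (\<exists>i\<in>{0..<int T}. \<exists>j\<in>{0..<int T}. side (x i) = 1 \<and> side (x j) = 2)"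

text \<open>Records only the sides in a window that sees at most one side, and the full word otherwise.\<close>

definition mixed_word :: "nat \<Rightarrow> (int \<Rightarrow> nat) \<Rightarrow> int \<Rightarrow> nat" where
  "mixed_word T x = restrict (\<lambda>t. if two_sided T x then x t else reduce 1 (x t)) {0..<int T}"

lemma two_sided_block:
  assumes "x \<in> tracks h" "two_sided T x"
  obtains a c where "a \<in> levels" "x \<in> block h a c" "2 * a < T" "c \<in> {0..int T}"
proof -
  obtain i j where ij: "i \<in> {0..<int T}" "j \<in> {0..<int T}" "side (x i) = 1" "side (x j) = 2"
    using assms(2) by (auto simp: two_sided_def)
  obtain a c where ac: "a \<in> levels" "x \<in> block h a c" by (rule tracks_block[OF assms(1) ij(3,4)])
  have "i < c - int a" "c + int a < j"
    using ij block_left_iff[OF ac(2), of i] block_right_iff[OF ac(2), of j] by simp_all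
  then show ?thesis using ij by (intro that[OF ac]) auto
qed

text \<open>A window that sees both sides contains the gap of a block, whose level is then at most \<open>b\<close>; level,
centre and the at most \<open>12 b\<close> left digits determine the word. Hence the count depends on \<open>T\<close> only
polynomially.\<close>

lemma card_mixed_words:
  assumes b: "\<And>a. a \<in> levels \<Longrightarrow> 2 * a < T \<Longrightarrow> a \<le> b"
  shows "finite (mixed_word T ` tracks h)"
    and "card (mixed_word T ` tracks h) \<le> (T + 1) ^ 4 * ((b + 2) * 6 ^ (12 * b))"
proof -
  define decode where "decode = (\<lambda>(a, c, g).
     restrict (\<lambda>t. if c - 13 * int a \<le> t \<and> t < c - int a then 3 * g (nat (t - (c - 13 * int a))) + 1
       else if c + int a < t \<and> t \<le> c + 13 * int a then 3 * g (nat (c + 13 * int a - t)) + 2 else (0::nat)) {0..<int T})"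
  let ?C = "{..b} \<times> {0..int T} \<times> ({..<12 * b} \<rightarrow>\<^sub>E {..<(6::nat)})"
  let ?U = "words h 1 {0..<int T} \<union> decode ` ?C"
  have sub: "mixed_word T ` tracks h \<subseteq> ?U"
  proof
    fix w assume "w \<in> mixed_word T ` tracks h"
    then obtain x where x: "x \<in> tracks h" and w: "w = mixed_word T x" by blast
    show "w \<in> ?U"
    proof (cases "two_sided T x")
      case False
      then have "w \<in> words h 1 {0..<int T}" using x by (auto simp: w mixed_word_def words_def)
      then show ?thesis ..
    next
      case True
      obtain a c where ac: "a \<in> levels" "x \<in> block h a c" "2 * a < T" "c \<in> {0..int T}"
        by (rule two_sided_block[OF x True])
      have ab: "a \<le> b" using b ac by blast
      \<comment> \<open>The digits are listed from the outer end inwards and padded by 0 from \<open>12 a\<close> to \<open>12 b\<close>.\<close>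
      define g where "g = restrict (\<lambda>i. if i < 12 * a then dig (x (c - 13 * int a + int i)) else 0) {..<12 * b}"
      have g: "g (nat i) = dig (x (c - 13 * int a + i))" if "0 \<le> i" "i < 12 * int a" for i
        using that ab by (auto simp: g_def)
      have val: "x t = side (x t) + 3 * dig (x t)" for t by simp
      have "w t = decode (a, c, g) t" for t
      proof (cases "t \<in> {0..<int T}")
        case t: True
        consider "c - 13 * int a \<le> t \<and> t < c - int a" | "c + int a < t \<and> t \<le> c + 13 * int a"
          | "\<not> (c - 13 * int a \<le> t \<and> t < c - int a)" "\<not> (c + int a < t \<and> t \<le> c + 13 * int a)" by blast
        then have "x t = (if c - 13 * int a \<le> t \<and> t < c - int a then 3 * g (nat (t - (c - 13 * int a))) + 1
           else if c + int a < t \<and> t \<le> c + 13 * int a then 3 * g (nat (c + 13 * int a - t)) + 2 else 0)"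
        proof cases
          case 1
          then have "side (x t) = 1" using block_left_iff[OF ac(2)] by blast
          moreover have "g (nat (t - (c - 13 * int a))) = dig (x t)"
            using g[of "t - (c - 13 * int a)"] 1 by simp
          ultimately show ?thesis using 1 val[of t] by simp
        next
          case 2
          have "x (c + (t - c)) = Suc (x (c - (t - c)))"
            using 2 by (intro block_mirror[OF ac(2)]) auto
          moreover have "side (x (c - (t - c))) = 1"
            using block_left_iff[OF ac(2), of "c - (t - c)"] 2 by simp
          moreover have "g (nat (c + 13 * int a - t)) = dig (x (c - (t - c)))"
            using g[of "c + 13 * int a - t"] 2 by (simp add: algebra_simps)
          ultimately show ?thesis using 2 val[of "c - (t - c)"] by simp
        next
          case 3
          then have "side (x t) = 0" using block_side[OF ac(2), of t] by auto
          then show ?thesis using 3 tracks_symbol[OF x, of t] by (auto simp: symbols_def)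
        qed
        then show ?thesis using t True by (simp add: w mixed_word_def decode_def)
      qed (auto simp: w mixed_word_def decode_def)
      then have "w = decode (a, c, g)" by (rule ext)
      moreover have "g \<in> {..<12 * b} \<rightarrow>\<^sub>E {..<6}"
        unfolding g_def using tracks_dig[OF x] by auto
      ultimately show ?thesis using ab ac(4) by blast
    qed
  qed
  have finC: "finite ?C" by (intro finite_cartesian_product finite_PiE) auto
  have W: "finite (words h 1 {0..<int T})" "card (words h 1 {0..<int T}) \<le> (T + 1) ^ 4"
    using card_words[of 0 "int T" 1 h] by simp_all
  have finU: "finite ?U" using W finC by blast
  then show "finite (mixed_word T ` tracks h)" using sub finite_subset by blast
  have "card ?C = (b + 1) * ((T + 1) * 6 ^ (12 * b))"
    by (simp only: card_cartesian_product card_PiE finite_lessThan) (simp add: nat_add_distrib)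
  also have "\<dots> \<le> (b + 1) * ((T + 1) ^ 4 * 6 ^ (12 * b))"
    by (intro mult_le_mono order_refl self_le_power) auto
  finally have C: "card (decode ` ?C) \<le> (b + 1) * ((T + 1) ^ 4 * 6 ^ (12 * b))"
    using card_image_le[OF finC, of decode] by linarith
  have "card (mixed_word T ` tracks h) \<le> card ?U" by (rule card_mono[OF finU sub])
  also have "\<dots> \<le> (T + 1) ^ 4 + (b + 1) * ((T + 1) ^ 4 * 6 ^ (12 * b))"
    using card_Un_le[of "words h 1 {0..<int T}" "decode ` ?C"] W(2) C by linarith
  also have "\<dots> \<le> (T + 1) ^ 4 * 6 ^ (12 * b) + (b + 1) * ((T + 1) ^ 4 * 6 ^ (12 * b))"
    by (intro add_mono order_refl) simp
  also have "\<dots> = (T + 1) ^ 4 * ((b + 2) * 6 ^ (12 * b))" by (simp add: algebra_simps)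
  finally show "card (mixed_word T ` tracks h) \<le> (T + 1) ^ 4 * ((b + 2) * 6 ^ (12 * b))" .
qed

lemma mixed_word_side:
  assumes "mixed_word T x = mixed_word T y" "t \<in> {0..<int T}"
  shows "side (x t) = side (y t)"
proof -
  have "side (mixed_word T x t) = side (x t)" for x using assms(2) by (simp add: mixed_word_def side_reduce)
  from this[of x] this[of y] assms(1) show ?thesis by simp
qed

lemma mixed_word_two_sided:
  assumes "mixed_word T x = mixed_word T y"
  shows "two_sided T x \<longleftrightarrow> two_sided T y"
  unfolding two_sided_def using mixed_word_side[OF assms] by simp

lemma mixed_word_eq:
  assumes "mixed_word T x = mixed_word T y" "two_sided T x" "t \<in> {0..<int T}"
  shows "x t = y t"
  using fun_cong[OF assms(1), of t] assms(2,3) mixed_word_two_sided[OF assms(1)] by (simp add: mixed_word_def)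

section \<open>Orbit distances and codes\<close>

lemma orbit_dist_less_iff:
  assumes "hub_isolated A" "0 < T"
  shows "orbit_dist (system A h) shift T x y < \<delta> \<longleftrightarrow>
    (\<forall>t<T. point_dist A ((shift ^^ t) x) ((shift ^^ t) y) < \<delta>)"
  unfolding orbit_dist_def mdist_system[OF assms(1)] using assms(2) by (subst Max_less_iff) auto

lemma orbit_dist_far:
  assumes A: "hub_isolated A" and t: "t < T" and far: "\<delta> \<le> (1/3) ^ m * sym_dist A (x m) (y m) (int t)"
  shows "\<delta> \<le> orbit_dist (system A h) shift T x y"
proof -
  have "\<delta> \<le> point_dist A ((shift ^^ t) x) ((shift ^^ t) y)"
    using point_dist_ge[of m 0 A "(shift ^^ t) x" "(shift ^^ t) y"] far by (simp add: sym_dist_shift)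
  then show ?thesis using orbit_dist_less_iff[OF A, of T h x y \<delta>] t by (auto simp: not_less)
qed

text \<open>Shifts by up to \<open>N\<close> matter, since the weight of track \<open>m\<close> at offset \<open>j\<close> is \<open>3^(-(m + |j|))\<close>.\<close>

definition window :: "nat \<Rightarrow> nat \<Rightarrow> int set" where
  "window N T = {- int N..<int T + int N + 1}"

text \<open>At a scale above \<open>3^(-(N+1))\<close>, once the tracks before \<open>N\<close> agree on the window, only track \<open>N\<close> at
offset 0 can still separate two orbits.\<close>

lemma orbit_dist_close:
  assumes A: "hub_isolated A" and T: "0 < T"
    and agree: "\<And>m t. m < N \<Longrightarrow> t \<in> window N T \<Longrightarrow> x m t = y m t"
    and near: "\<And>t. t < T \<Longrightarrow> (1/3) ^ N * sym_dist A (x N) (y N) (int t) < \<delta>"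
    and \<delta>: "(1/3) ^ Suc N < \<delta>"
  shows "orbit_dist (system A h) shift T x y < \<delta>"
  unfolding orbit_dist_less_iff[OF A T]
proof (intro allI impI)
  fix t assume t: "t < T"
  let ?b = "max ((1/3) ^ N * sym_dist A (x N) (y N) (int t)) ((1/3::real) ^ Suc N)"
  have "point_dist A ((shift ^^ t) x) ((shift ^^ t) y) \<le> ?b"
  proof (rule point_dist_leI)
    fix m j
    let ?e = "sym_dist A ((shift ^^ t) x m) ((shift ^^ t) y m) j"
    consider "m < N" "\<bar>j\<bar> \<le> int N" | "m = N" "j = 0" | "Suc N \<le> m + nat \<bar>j\<bar>" by linarith
    then show "(1/3) ^ (m + nat \<bar>j\<bar>) * ?e \<le> ?b"
    proof cases
      case 1
      then have "x m (j + int t) = y m (j + int t)" using t by (intro agree) (auto simp: window_def)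
      then have "?e = 0" by (simp add: sym_dist_shift sym_dist_same)
      then show ?thesis by (simp add: le_max_iff_disj)
    next
      case 2
      then show ?thesis by (simp add: sym_dist_shift)
    next
      case 3
      have "(1/3) ^ (m + nat \<bar>j\<bar>) * ?e \<le> (1/3) ^ (m + nat \<bar>j\<bar>)" by (rule dist_term_le)
      also have "\<dots> \<le> (1/3) ^ Suc N" using 3 by (intro power_decreasing) auto
      finally show ?thesis by simp
    qed
  qed
  also have "?b < \<delta>" using near[OF t] \<delta> by simp
  finally show "point_dist A ((shift ^^ t) x) ((shift ^^ t) y) < \<delta>" .
qed

text \<open>The visible part of a point at scale \<open>3^(-N)\<close>: full words on the tracks before \<open>N\<close>, and some
information \<open>\<kappa>\<close> about track \<open>N\<close>.\<close>

definition code :: "nat \<Rightarrow> nat \<Rightarrow> ((int \<Rightarrow> nat) \<Rightarrow> 'c) \<Rightarrow> point \<Rightarrow> (nat \<Rightarrow> int \<Rightarrow> nat) \<times> 'c" where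
  "code N T \<kappa> x = (restrict (\<lambda>m. restrict (x m) (window N T)) {..<N}, \<kappa> (x N))"

definition codes :: "bool \<Rightarrow> nat \<Rightarrow> nat \<Rightarrow> ((int \<Rightarrow> nat) \<Rightarrow> 'c) \<Rightarrow> ((nat \<Rightarrow> int \<Rightarrow> nat) \<times> 'c) set" where
  "codes h N T \<kappa> = ({..<N} \<rightarrow>\<^sub>E words h 6 (window N T)) \<times> \<kappa> ` tracks h"

text \<open>Bounds the number of words that \<open>N\<close> tracks show on the window. Its exponential growth rate in \<open>T\<close>
is \<open>N ln 6\<close>.\<close>

definition word_bound :: "nat \<Rightarrow> nat \<Rightarrow> nat" where
  "word_bound N T = ((T + 2 * N + 2) ^ 4 * 6 ^ (T + 2 * N + 1)) ^ N"

lemma code_in_codes: "x \<in> points h \<Longrightarrow> code N T \<kappa> x \<in> codes h N T \<kappa>"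
proof -
  assume x: "x \<in> points h"
  have "restrict (x m) (window N T) = restrict (\<lambda>t. reduce 6 (x m t)) (window N T)" for m
    using x by (intro restrict_ext) (simp add: points_def reduce_6 tracks_symbol[where h=h])
  moreover have "x m \<in> tracks h" for m using x by (simp add: points_def)
  ultimately show ?thesis by (auto simp: code_def codes_def words_def)
qed

lemma code_eq_agree: "code N T \<kappa> x = code N T \<kappa> y \<Longrightarrow> m < N \<Longrightarrow> t \<in> window N T \<Longrightarrow> x m t = y m t"
proof -
  assume eq: "code N T \<kappa> x = code N T \<kappa> y" and m: "m < N" and t: "t \<in> window N T"
  have "fst (code N T \<kappa> x) m t = fst (code N T \<kappa> y) m t" by (simp add: eq)
  then show "x m t = y m t" using m t by (simp add: code_def)
qed

lemma code_eq_last: "code N T \<kappa> x = code N T \<kappa> y \<Longrightarrow> \<kappa> (x N) = \<kappa> (y N)"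
  by (simp add: code_def)

lemma codes_finite_card:
  assumes "finite (\<kappa> ` tracks h)" "card (\<kappa> ` tracks h) \<le> B"
  shows "finite (codes h N T \<kappa>)" "card (codes h N T \<kappa>) \<le> word_bound N T * B"
proof -
  have len: "nat (int T + int N + 1 - - int N) = T + 2 * N + 1" by simp
  have "finite (words h 6 (window N T))"
    and W: "card (words h 6 (window N T)) \<le> (T + 2 * N + 2) ^ 4 * 6 ^ (T + 2 * N + 1)"
    using card_words[of "- int N" "int T + int N + 1" 6 h, unfolded len]
    by (simp_all only: window_def) (simp_all add: algebra_simps)
  then show "finite (codes h N T \<kappa>)" using assms(1) by (auto simp: codes_def intro!: finite_PiE)
  have "card (codes h N T \<kappa>) = card (words h 6 (window N T)) ^ N * card (\<kappa> ` tracks h)"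
    by (simp add: codes_def card_cartesian_product card_PiE)
  also have "\<dots> \<le> word_bound N T * B"
    unfolding word_bound_def using W assms(2) by (intro mult_le_mono power_mono) auto
  finally show "card (codes h N T \<kappa>) \<le> word_bound N T * B" .
qed

abbreviation sep_size :: "digit_graph \<Rightarrow> bool \<Rightarrow> nat \<Rightarrow> real \<Rightarrow> nat" where
  "sep_size A h T \<delta> \<equiv> sep_num (points h) \<delta> (orbit_dist (system A h) shift T)"

abbreviation span_size :: "digit_graph \<Rightarrow> bool \<Rightarrow> nat \<Rightarrow> real \<Rightarrow> nat" where
  "span_size A h T \<delta> \<equiv> span_num (points h) \<delta> (orbit_dist (system A h) shift T)"

text \<open>Points of a separated set with equal codes are told apart by track \<open>N\<close> alone, so it suffices to
bound sets of tracks.\<close>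

lemma card_separated_le:
  assumes A: "hub_isolated A" and T: "0 < T" and \<delta>: "(1/3) ^ Suc N < \<delta>"
    and \<kappa>: "finite (\<kappa> ` tracks h)" "card (\<kappa> ` tracks h) \<le> B"
    and fibre: "\<And>K c. K \<subseteq> tracks h \<Longrightarrow> finite K \<Longrightarrow> (\<And>x. x \<in> K \<Longrightarrow> \<kappa> x = c) \<Longrightarrow>
       (\<And>x y. x \<in> K \<Longrightarrow> y \<in> K \<Longrightarrow> x \<noteq> y \<Longrightarrow> \<exists>t<T. \<delta> \<le> (1/3) ^ N * sym_dist A x y (int t)) \<Longrightarrow> card K \<le> M"
    and S: "S \<subseteq> points h" "finite S" "separated_set \<delta> (orbit_dist (system A h) shift T) S"
  shows "card S \<le> word_bound N T * B * M"
proof -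
  have "card S \<le> card (codes h N T \<kappa>) * M"
  proof (rule card_le_fibres[OF S(2) codes_finite_card(1)[OF \<kappa>]])
    show "code N T \<kappa> ` S \<subseteq> codes h N T \<kappa>" using S(1) code_in_codes by blast
    fix c
    let ?F = "{x \<in> S. code N T \<kappa> x = c}"
    have pair: "\<exists>t<T. \<delta> \<le> (1/3) ^ N * sym_dist A (x N) (y N) (int t)"
      if xy: "x \<in> ?F" "y \<in> ?F" "x \<noteq> y" for x y
    proof (rule ccontr)
      assume "\<not> ?thesis"
      then have "orbit_dist (system A h) shift T x y < \<delta>"
        using xy by (intro orbit_dist_close[OF A T _ _ \<delta>] code_eq_agree[of N T \<kappa> x y]) (auto simp: not_le)
      then show False using S(3) xy by (force simp: separated_set_def)
    qed
    have "inj_on (\<lambda>x. x N) ?F"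
    proof (rule inj_onI, rule ccontr)
      fix x y assume xy: "x \<in> ?F" "y \<in> ?F" "x N = y N" "x \<noteq> y"
      obtain t where "\<delta> \<le> (1/3) ^ N * sym_dist A (x N) (y N) (int t)" using pair[OF xy(1,2,4)] by blast
      moreover have "0 < (1/3::real) ^ Suc N" by simp
      ultimately show False using xy(3) \<delta> by (simp add: sym_dist_same)
    qed
    then have "card ?F = card ((\<lambda>x. x N) ` ?F)" by (simp add: card_image)
    also have "\<dots> \<le> M"
    proof (rule fibre[where c="snd c"])
      show "\<And>x y. x \<in> (\<lambda>x. x N) ` ?F \<Longrightarrow> y \<in> (\<lambda>x. x N) ` ?F \<Longrightarrow> x \<noteq> y \<Longrightarrow>
          \<exists>t<T. \<delta> \<le> (1/3) ^ N * sym_dist A x y (int t)"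
        using pair by blast
    qed (use S in \<open>auto simp: points_def code_def\<close>)
    finally show "card ?F \<le> M" .
  qed
  also have "\<dots> \<le> word_bound N T * B * M" by (intro mult_le_mono1 codes_finite_card \<kappa>)
  finally show ?thesis .
qed

lemma card_le_1_of_all_equal:
  assumes "finite K" "\<And>x y. x \<in> K \<Longrightarrow> y \<in> K \<Longrightarrow> x \<noteq> y \<Longrightarrow> False"
  shows "card K \<le> 1"
  using card_le_Suc0_iff_eq[OF assms(1)] assms(2) by auto

lemma card_separated_le_code_count:
  assumes A: "hub_isolated A" and T: "0 < T" and \<delta>: "(1/3) ^ Suc N < \<delta>"
    and \<kappa>: "finite (\<kappa> ` tracks h)" "card (\<kappa> ` tracks h) \<le> B"
    and near: "\<And>x y t. x \<in> tracks h \<Longrightarrow> y \<in> tracks h \<Longrightarrow> \<kappa> x = \<kappa> y \<Longrightarrow> t < T \<Longrightarrow>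
       (1/3) ^ N * sym_dist A x y (int t) < \<delta>"
    and S: "S \<subseteq> points h" "finite S" "separated_set \<delta> (orbit_dist (system A h) shift T) S"
  shows "card S \<le> word_bound N T * B"
proof -
  have "card S \<le> word_bound N T * B * 1"
  proof (rule card_separated_le[OF A T \<delta> \<kappa> _ S])
    fix K c
    assume K: "K \<subseteq> tracks h" "finite K" "\<And>x. x \<in> K \<Longrightarrow> \<kappa> x = c"
      and far: "\<And>x y. x \<in> K \<Longrightarrow> y \<in> K \<Longrightarrow> x \<noteq> y \<Longrightarrow> \<exists>t<T. \<delta> \<le> (1/3) ^ N * sym_dist A x y (int t)"
    show "card K \<le> 1"
    proof (rule card_le_1_of_all_equal[OF K(2)])
      fix x y assume xy: "x \<in> K" "y \<in> K" "x \<noteq> y"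
      from far[OF this] obtain t where t: "t < T" "\<delta> \<le> (1/3) ^ N * sym_dist A x y (int t)" by blast
      have "x \<in> tracks h" "y \<in> tracks h" "\<kappa> x = \<kappa> y" using xy K by auto
      from near[OF this t(1)] t(2) show False by linarith
    qed
  qed
  then show ?thesis by simp
qed

text \<open>For a large \<open>N\<close> the tracks before \<open>N\<close> determine a point up to \<open>\<delta>\<close>.\<close>

lemma separated_bounded:
  assumes A: "hub_isolated A" and T: "0 < T" and \<delta>: "0 < \<delta>"
  obtains B where "\<And>S. S \<subseteq> points h \<Longrightarrow> finite S \<Longrightarrow>
    separated_set \<delta> (orbit_dist (system A h) shift T) S \<Longrightarrow> card S \<le> B"
proof -
  obtain N where N: "(1/3::real) ^ N < \<delta>" using real_arch_pow_inv[OF \<delta>, of "1/3"] by auto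
  have "(1/3::real) ^ Suc N \<le> (1/3) ^ N" by (intro power_decreasing) auto
  then have N': "(1/3::real) ^ Suc N < \<delta>" using N by linarith
  have fin: "finite ((\<lambda>_. ()) ` tracks h)" "card ((\<lambda>_. ()) ` tracks h) \<le> 1"
    using card_mono[of "{()}" "(\<lambda>_. ()) ` tracks h"] by (simp_all add: subset_iff)
  have near: "(1/3) ^ N * sym_dist A x y (int t) < \<delta>" for x y t
  proof -
    have "(1/3) ^ N * sym_dist A x y (int t) \<le> (1/3) ^ N"
      by (rule mult_left_le[OF sym_dist_le_1]) simp
    then show ?thesis using N by linarith
  qed
  show ?thesis
  proof (rule that)
    fix S assume S: "S \<subseteq> points h" "finite S" "separated_set \<delta> (orbit_dist (system A h) shift T) S"
    show "card S \<le> word_bound N T * 1"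
      by (rule card_separated_le_code_count[OF A T N' fin near S])
  qed
qed

lemma orbit_dist_refl:
  assumes "hub_isolated A" "0 < T" "0 < \<delta>"
  shows "orbit_dist (system A h) shift T x x < \<delta>"
proof -
  have "point_dist A z z = 0" for z by (simp add: point_dist_eq_0_iff)
  then show ?thesis using assms by (simp add: orbit_dist_less_iff)
qed

lemma orbit_dist_commute:
  assumes "hub_isolated A"
  shows "orbit_dist (system A h) shift T x y = orbit_dist (system A h) shift T y x"
  unfolding orbit_dist_def mdist_system[OF assms] by (subst point_dist_commute[OF assms]) simp

lemma finite_spanning_set:
  assumes A: "hub_isolated A" and T: "0 < T" and \<delta>: "0 < \<delta>"
  shows "\<exists>S\<subseteq>points h. finite S \<and> spanning_set (points h) \<delta> (orbit_dist (system A h) shift T) S \<and>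
           card S = sep_size A h T \<delta>"
proof -
  obtain B where B: "\<And>S. S \<subseteq> points h \<Longrightarrow> finite S \<Longrightarrow>
    separated_set \<delta> (orbit_dist (system A h) shift T) S \<Longrightarrow> card S \<le> B"
    using separated_bounded[OF assms] by blast
  show ?thesis
    by (rule maximal_separated_spans[OF B orbit_dist_refl[OF assms] orbit_dist_commute[OF A]])
qed

lemma span_size_le_sep_size:
  assumes "hub_isolated A" "0 < T" "0 < \<delta>"
  shows "span_size A h T \<delta> \<le> sep_size A h T \<delta>"
  using finite_spanning_set[OF assms, of h] span_num_le by metis

lemma span_size_pos:
  assumes "hub_isolated A" "0 < T" "0 < \<delta>" "points h \<noteq> {}"
  shows "0 < span_size A h T \<delta>"
proof -
  obtain p where p: "p \<in> points h" using assms(4) by blast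
  obtain S where "S \<subseteq> points h" "finite S" "spanning_set (points h) \<delta> (orbit_dist (system A h) shift T) S"
    using finite_spanning_set[OF assms(1-3)] by blast
  from card_le_span_num[OF this, of "{p}"] p show ?thesis by simp
qed

text \<open>Changing only track \<open>N\<close> of a representative by \<open>s\<close> brings it close to every point with the same code.\<close>

lemma span_size_le_code_count:
  assumes A: "hub_isolated A" and T: "0 < T" and \<delta>: "(1/3) ^ Suc N < \<delta>"
    and \<kappa>: "finite (\<kappa> ` tracks h)" "card (\<kappa> ` tracks h) \<le> B"
    and s: "\<And>x. x \<in> tracks h \<Longrightarrow> s x \<in> tracks h"
    and near: "\<And>x y t. x \<in> tracks h \<Longrightarrow> y \<in> tracks h \<Longrightarrow> \<kappa> x = \<kappa> y \<Longrightarrow> t < T \<Longrightarrow>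
       (1/3) ^ N * sym_dist A (s x) y (int t) < \<delta>"
  shows "span_size A h T \<delta> \<le> word_bound N T * B"
proof -
  have "span_size A h T \<delta> \<le> card (codes h N T \<kappa>)"
  proof (rule span_num_le_code[where \<kappa>="code N T \<kappa>" and s="\<lambda>x. x(N := s (x N))"])
    show "finite (codes h N T \<kappa>)" by (rule codes_finite_card[OF \<kappa>])
    show "code N T \<kappa> ` points h \<subseteq> codes h N T \<kappa>" using code_in_codes by blast
    show "x(N := s (x N)) \<in> points h" if "x \<in> points h" for x
      using that s by (simp add: points_def)
    show "orbit_dist (system A h) shift T (x(N := s (x N))) y < \<delta>"
      if xy: "x \<in> points h" "y \<in> points h" "code N T \<kappa> x = code N T \<kappa> y" for x y
    proof (rule orbit_dist_close[OF A T _ _ \<delta>])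
      fix m t assume "m < N" "t \<in> window N T"
      then show "(x(N := s (x N))) m t = y m t" using code_eq_agree[OF xy(3)] by simp
    next
      fix t assume "t < T"
      then show "(1/3) ^ N * sym_dist A ((x(N := s (x N))) N) (y N) (int t) < \<delta>"
        using xy near[of "x N" "y N" t] code_eq_last[OF xy(3)] by (simp add: points_def)
    qed
  qed
  also have "\<dots> \<le> word_bound N T * B" by (rule codes_finite_card[OF \<kappa>])
  finally show ?thesis .
qed

section \<open>Families of points with prescribed tracks\<close>

definition lines :: "nat \<Rightarrow> nat \<Rightarrow> (int \<Rightarrow> nat) set" where
  "lines T q = (\<lambda>g t. if 0 \<le> t \<and> t < int T then 3 * g t + 1 else 1) ` ({0..<int T} \<rightarrow>\<^sub>E {..<q})"

lemma card_lines: "finite (lines T q)" "card (lines T q) = q ^ T"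
proof -
  let ?L = "\<lambda>(g :: int \<Rightarrow> nat) t. if 0 \<le> t \<and> t < int T then 3 * g t + 1 else 1"
  have "inj_on ?L ({0..<int T} \<rightarrow>\<^sub>E {..<q})"
  proof (rule inj_onI)
    fix g g' assume g: "g \<in> {0..<int T} \<rightarrow>\<^sub>E {..<q}" "g' \<in> {0..<int T} \<rightarrow>\<^sub>E {..<q}" "?L g = ?L g'"
    show "g = g'"
    proof (rule PiE_ext[OF g(1,2)])
      fix t assume "t \<in> {0..<int T}"
      with fun_cong[OF g(3), of t] show "g t = g' t" by simp
    qed
  qed
  then show "card (lines T q) = q ^ T" unfolding lines_def by (simp add: card_image card_PiE)
  show "finite (lines T q)" unfolding lines_def by (intro finite_imageI finite_PiE) auto
qed

lemma lines_side: "x \<in> lines T q \<Longrightarrow> side (x t) = 1"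
  by (auto simp: lines_def)

lemma lines_outside: "x \<in> lines T q \<Longrightarrow> t < 0 \<or> int T \<le> t \<Longrightarrow> x t = 1"
  by (auto simp: lines_def)

lemma lines_dig: "x \<in> lines T q \<Longrightarrow> 0 < q \<Longrightarrow> dig (x t) < q"
  by (force simp: lines_def PiE_iff)

lemma lines_subset_tracks:
  assumes "0 < q" "q \<le> 6" shows "lines T q \<subseteq> tracks h"
proof
  fix x assume x: "x \<in> lines T q"
  show "x \<in> tracks h"
    by (rule tracksI_one_sided)
      (use lines_side[OF x] lines_dig[OF x assms(1)] assms(2) in \<open>auto simp: symbols_def intro: less_le_trans\<close>)
qed

text \<open>Tracks before \<open>N\<close> carry arbitrary digits during the first \<open>T\<close> times, independently of track \<open>N\<close>.\<close>

definition family :: "nat \<Rightarrow> nat \<Rightarrow> (int \<Rightarrow> nat) set \<Rightarrow> point set" where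
  "family N T \<Phi> = (\<lambda>(f, \<phi>) m. if m < N then f m else if m = N then \<phi> else (\<lambda>_. 0)) `
     (({..<N} \<rightarrow>\<^sub>E lines T 6) \<times> \<Phi>)"

lemma family_subset_points:
  assumes "\<Phi> \<subseteq> tracks h" shows "family N T \<Phi> \<subseteq> points h"
proof
  fix p assume "p \<in> family N T \<Phi>"
  then obtain f \<phi> where f: "f \<in> {..<N} \<rightarrow>\<^sub>E lines T 6" "\<phi> \<in> \<Phi>"
    and p: "p = (\<lambda>m. if m < N then f m else if m = N then \<phi> else (\<lambda>_. 0))"
    by (auto simp: family_def)
  have "f m \<in> tracks h" if "m < N" for m
    using that f(1) lines_subset_tracks[of 6 T h] by (auto dest: PiE_mem)
  then show "p \<in> points h" using f(2) assms zero_track[of h] by (auto simp: p points_def)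
qed

lemma familyD:
  assumes "p \<in> family N T \<Phi>"
  shows "m < N \<Longrightarrow> p m \<in> lines T 6" "p N \<in> \<Phi>" "N < m \<Longrightarrow> p m = (\<lambda>_. 0)"
proof -
  obtain f \<phi> where f: "f \<in> {..<N} \<rightarrow>\<^sub>E lines T 6" "\<phi> \<in> \<Phi>"
    and p: "p = (\<lambda>m. if m < N then f m else if m = N then \<phi> else (\<lambda>_. 0))"
    using assms by (auto simp: family_def)
  show "m < N \<Longrightarrow> p m \<in> lines T 6" "p N \<in> \<Phi>" "N < m \<Longrightarrow> p m = (\<lambda>_. 0)"
    using f by (auto simp: p dest: PiE_mem)
qed

lemma card_family:
  assumes "finite \<Phi>"
  shows "finite (family N T \<Phi>)" "card (family N T \<Phi>) = (6 ^ T) ^ N * card \<Phi>"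
proof -
  let ?p = "\<lambda>(f, \<phi>) m. if m < N then f m else if m = N then \<phi> else (\<lambda>_. 0 :: nat)"
  have "inj_on ?p (({..<N} \<rightarrow>\<^sub>E lines T 6) \<times> \<Phi>)"
  proof (rule inj_onI, clarify)
    fix f \<phi> f' \<phi>' assume f: "f \<in> {..<N} \<rightarrow>\<^sub>E lines T 6" "f' \<in> {..<N} \<rightarrow>\<^sub>E lines T 6"
      and eq: "(\<lambda>m. if m < N then f m else if m = N then \<phi> else (\<lambda>_. 0)) =
         (\<lambda>m. if m < N then f' m else if m = N then \<phi>' else (\<lambda>_. 0))"
    have "f = f'"
    proof (rule PiE_ext[OF f])
      fix m assume "m \<in> {..<N}"
      with fun_cong[OF eq, of m] show "f m = f' m" by simp
    qed
    moreover have "\<phi> = \<phi>'" using fun_cong[OF eq, of N] by simp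
    ultimately show "f = f' \<and> \<phi> = \<phi>'" ..
  qed
  then show "card (family N T \<Phi>) = (6 ^ T) ^ N * card \<Phi>"
    unfolding family_def by (simp add: card_image card_cartesian_product card_PiE card_lines)
  show "finite (family N T \<Phi>)"
    unfolding family_def using assms
    by (intro finite_imageI finite_cartesian_product finite_PiE card_lines) auto
qed

lemma family_coarse_tracks_eq:
  assumes p: "p \<in> family N T \<Phi>" and q: "q \<in> family N T \<Phi>" and m: "m < N"
    and agree: "\<And>t. t < T \<Longrightarrow> p m (int t) = q m (int t)"
  shows "p m = q m"
proof
  fix t
  have pq: "p m \<in> lines T 6" "q m \<in> lines T 6" using familyD[OF p] familyD[OF q] m by auto
  show "p m t = q m t"
  proof (cases "0 \<le> t \<and> t < int T")
    case True
    then have "nat t < T" "int (nat t) = t" by linarith+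
    then show ?thesis using agree[of "nat t"] by simp
  next
    case False
    then show ?thesis using lines_outside[OF pq(1), of t] lines_outside[OF pq(2), of t] by force
  qed
qed

text \<open>Distinct symbols on a track of weight at least \<open>2 \<delta>\<close> separate whatever the rest of the tracks is.\<close>

lemma coarse_track_far:
  assumes A: "hub_isolated A" and \<delta>: "\<delta> \<le> (1/3) ^ m / 2" and t: "t < T"
    and near: "orbit_dist (system A h) shift T x y < \<delta>"
  shows "x m (int t) = y m (int t)"
proof (rule ccontr)
  assume "\<not> ?thesis"
  then have "(1/3) ^ m * (1/2) \<le> (1/3) ^ m * sym_dist A (x m) (y m) (int t)"
    by (intro mult_left_mono sym_dist_ge_half) auto
  then have "\<delta> \<le> (1/3) ^ m * sym_dist A (x m) (y m) (int t)" using \<delta> by linarith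
  then have "\<delta> \<le> orbit_dist (system A h) shift T x y" by (rule orbit_dist_far[OF A t])
  with near show False by simp
qed

lemma family_eqI:
  assumes "p \<in> family N T \<Phi>" "q \<in> family N T \<Phi>" "\<And>m. m < N \<Longrightarrow> p m = q m" "p N = q N"
  shows "p = q"
proof
  fix m consider "m < N" | "m = N" | "N < m" by linarith
  then show "p m = q m" by cases (use assms familyD(3)[of _ N T \<Phi> m] in auto)
qed

text \<open>The tracks before \<open>N\<close> of a family member are visible to every point close to it, so uniqueness
has to be checked on track \<open>N\<close> only.\<close>

lemma family_card_le_span_size:
  assumes A: "hub_isolated A" and T: "0 < T" and \<delta>0: "0 < \<delta>" and \<delta>: "\<And>m. m < N \<Longrightarrow> \<delta> \<le> (1/3) ^ m / 2"
    and \<Phi>: "\<Phi> \<subseteq> tracks h" "finite \<Phi>"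
    and uniq: "\<And>s \<phi> \<phi>'. s \<in> tracks h \<Longrightarrow> \<phi> \<in> \<Phi> \<Longrightarrow> \<phi>' \<in> \<Phi> \<Longrightarrow>
       (\<And>t. t < T \<Longrightarrow> (1/3) ^ N * sym_dist A s \<phi> (int t) < \<delta>) \<Longrightarrow>
       (\<And>t. t < T \<Longrightarrow> (1/3) ^ N * sym_dist A s \<phi>' (int t) < \<delta>) \<Longrightarrow> \<phi> = \<phi>'"
  shows "(6 ^ T) ^ N * card \<Phi> \<le> span_size A h T \<delta>"
proof -
  obtain S0 where S0: "S0 \<subseteq> points h" "finite S0"
      "spanning_set (points h) \<delta> (orbit_dist (system A h) shift T) S0"
    using finite_spanning_set[OF A T \<delta>0] by blast
  have "card (family N T \<Phi>) \<le> span_size A h T \<delta>"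
  proof (rule card_le_span_num[OF S0 family_subset_points[OF \<Phi>(1)]])
    fix s p p' assume s: "s \<in> points h" and p: "p \<in> family N T \<Phi>" "p' \<in> family N T \<Phi>"
      and d: "orbit_dist (system A h) shift T s p < \<delta>" "orbit_dist (system A h) shift T s p' < \<delta>"
    show "p = p'"
    proof (rule family_eqI[OF p])
      fix m assume m: "m < N"
      show "p m = p' m"
      proof (rule family_coarse_tracks_eq[OF p m])
        fix t assume t: "t < T"
        show "p m (int t) = p' m (int t)"
          using coarse_track_far[OF A \<delta>[OF m] t d(1)] coarse_track_far[OF A \<delta>[OF m] t d(2)] by simp
      qed
    next
      have "(1/3) ^ N * sym_dist A (s N) (q N) (int t) < \<delta>"
        if "orbit_dist (system A h) shift T s q < \<delta>" "t < T" for q t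
        using orbit_dist_far[OF A that(2), of \<delta> N s q h] that(1) by linarith
      then show "p N = p' N"
        using s d familyD(2)[OF p(1)] familyD(2)[OF p(2)] by (intro uniq[of "s N"]) (auto simp: points_def)
    qed
  qed
  then show ?thesis by (simp add: card_family[OF \<Phi>(2)])
qed

lemma family_card_le_sep_size:
  assumes A: "hub_isolated A" and T: "0 < T" and \<delta>0: "0 < \<delta>" and \<delta>: "\<And>m. m < N \<Longrightarrow> \<delta> \<le> (1/3) ^ m / 2"
    and \<Phi>: "\<Phi> \<subseteq> tracks h" "finite \<Phi>"
    and far: "\<And>\<phi> \<phi>'. \<phi> \<in> \<Phi> \<Longrightarrow> \<phi>' \<in> \<Phi> \<Longrightarrow> \<phi> \<noteq> \<phi>' \<Longrightarrow> \<exists>t<T. \<delta> \<le> (1/3) ^ N * sym_dist A \<phi> \<phi>' (int t)"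
  shows "(6 ^ T) ^ N * card \<Phi> \<le> sep_size A h T \<delta>"
proof -
  obtain B where B: "\<And>S. S \<subseteq> points h \<Longrightarrow> finite S \<Longrightarrow>
    separated_set \<delta> (orbit_dist (system A h) shift T) S \<Longrightarrow> card S \<le> B"
    using separated_bounded[OF A T \<delta>0] by blast
  have "separated_set \<delta> (orbit_dist (system A h) shift T) (family N T \<Phi>)"
    unfolding separated_set_def
  proof (intro ballI impI, rule ccontr)
    fix p p' assume p: "p \<in> family N T \<Phi>" "p' \<in> family N T \<Phi>" "p \<noteq> p'"
      and "\<not> \<delta> \<le> orbit_dist (system A h) shift T p p'"
    then have d: "orbit_dist (system A h) shift T p p' < \<delta>" by simp
    have "p = p'"
    proof (rule family_eqI[OF p(1,2)])
      fix m assume m: "m < N"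
      show "p m = p' m"
        by (rule family_coarse_tracks_eq[OF p(1,2) m]) (auto intro: coarse_track_far[OF A \<delta>[OF m] _ d])
    next
      show "p N = p' N"
        using far[OF familyD(2)[OF p(1)] familyD(2)[OF p(2)]] orbit_dist_far[OF A, of _ T \<delta> N p p' h] d
        by (metis not_less)
    qed
    with p(3) show False ..
  qed
  then have "card (family N T \<Phi>) \<le> sep_size A h T \<delta>"
    by (intro card_le_sep_num[OF B] family_subset_points \<Phi> card_family)
  then show ?thesis by (simp add: card_family[OF \<Phi>(2)])
qed

section \<open>Spanning by hubs\<close>

lemma sym_dist_le_half:
  assumes "side (x t) = side (y t)" "x t \<noteq> y t \<Longrightarrow> \<not> A (side (x t)) (dig (x t)) (dig (y t))"
  shows "sym_dist A x y t \<le> 1/2"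
  using assms by (auto simp: sym_dist_def)

lemma near_of_half: "sym_dist A x y t \<le> 1/2 \<Longrightarrow> (1/3) ^ N / 2 < \<delta> \<Longrightarrow> (1/3) ^ N * sym_dist A x y t < \<delta>"
proof -
  assume half: "sym_dist A x y t \<le> 1/2" and \<delta>: "(1/3) ^ N / 2 < \<delta>"
  have "(1/3) ^ N * sym_dist A x y t \<le> (1/3) ^ N * (1/2)" using half by (intro mult_left_mono) auto
  then show ?thesis using \<delta> by linarith
qed

definition hub :: "nat \<Rightarrow> nat" where
  "hub v = (if side v = 0 then 0 else side v + 15)"

lemma side_hub: "side (hub v) = side v"
  unfolding hub_def by presburger

lemma hub_symbol: "hub v \<in> symbols"
  unfolding hub_def symbols_def mem_Collect_eq by presburger

text \<open>The hub is within \<open>1/2\<close> of every digit of its side, because it has no edges.\<close>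

lemma sym_dist_hub_le_half:
  assumes A: "hub_isolated A" and y: "y \<in> tracks h" and x: "x t = hub (y t)"
  shows "sym_dist A x y t \<le> 1/2"
proof (rule sym_dist_le_half)
  show "side (x t) = side (y t)" by (simp add: x side_hub)
  assume "x t \<noteq> y t"
  then have "side (y t) \<noteq> 0" using tracks_symbol[OF y, of t] by (auto simp: x hub_def symbols_def)
  moreover have "side (y t) < 3" by simp
  ultimately have "dig (x t) = 5" by (simp add: x hub_def)
  then show "\<not> A (side (x t)) (dig (x t)) (dig (y t))" using A by (force simp: hub_isolated_def)
qed

lemma hub_block:
  assumes "x \<in> block True a c" shows "(\<lambda>t. hub (x t)) \<in> block True a c"
proof -
  have "hub (x (c + j)) = Suc (hub (x (c - j)))" if j: "int a < j" "j \<le> 13 * int a" for j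
  proof -
    have "side (x (c - j)) = 1" "side (x (c + j)) = 2"
      using j block_left_iff[OF assms, of "c - j"] block_right_iff[OF assms, of "c + j"] by auto
    then show ?thesis by (simp add: hub_def)
  qed
  then show ?thesis using assms by (simp add: block_def side_hub)
qed

lemma hub_tracks:
  assumes x: "x \<in> tracks True" shows "(\<lambda>t. hub (x t)) \<in> tracks True"
proof -
  have "\<exists>a\<in>levels. \<exists>c. (\<lambda>t. hub (x t)) \<in> block True a c" if "side (x i) = 1" "side (x j) = 2" for i j
    using tracks_block[OF x that] hub_block by metis
  then show ?thesis
    using x unfolding tracks_def mem_Collect_eq side_hub by (meson hub_symbol)
qed

lemma words_eq_reduce:
  assumes "restrict (\<lambda>t. reduce q (x t)) {0..<int T} = restrict (\<lambda>t. reduce q (y t)) {0..<int T}" "t < T"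
  shows "reduce q (x (int t)) = reduce q (y (int t))"
  using fun_cong[OF assms(1), of "int t"] assms(2) by simp

lemma words_card_bound:
  assumes "0 < q"
  shows "finite ((\<lambda>x. restrict (\<lambda>t. reduce q (x t)) {0..<int T}) ` tracks h)"
    "card ((\<lambda>x. restrict (\<lambda>t. reduce q (x t)) {0..<int T}) ` tracks h) \<le> (T + 1) ^ 4 * q ^ T"
  using card_words[of 0 "int T" q h] assms unfolding words_def by simp_all

text \<open>With hubs allowed in blocks, the tracks from \<open>N\<close> on may be filled with hubs. Here \<open>N\<close> is the number of
tracks on which all distinct symbols are \<open>\<delta>\<close>-apart.\<close>

lemma span_size_hub_bounds:
  assumes A: "hub_isolated A" and T: "0 < T"
    and N: "(1/3) ^ N / 2 < \<delta>" "\<And>m. m < N \<Longrightarrow> \<delta> \<le> (1/3) ^ m / 2"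
  shows "(6 ^ T) ^ N \<le> span_size A True T \<delta>" "span_size A True T \<delta> \<le> word_bound N T * (T + 1) ^ 4"
proof -
  have pos: "0 < (1/3::real) ^ N" by simp
  have "(1/3::real) ^ Suc N = (1/3) ^ N / 3" by simp
  then have \<delta>: "0 < \<delta>" "(1/3) ^ Suc N < \<delta>" using pos N(1) by linarith+
  have "(6 ^ T) ^ N * card {\<lambda>_ :: int. 0 :: nat} \<le> span_size A True T \<delta>"
    by (rule family_card_le_span_size[OF A T \<delta>(1) N(2)]) (auto simp: zero_track)
  then show "(6 ^ T) ^ N \<le> span_size A True T \<delta>" by simp
  have "span_size A True T \<delta> \<le> word_bound N T * ((T + 1) ^ 4 * 1 ^ T)"
  proof (rule span_size_le_code_count[OF A T \<delta>(2) words_card_bound, where s="\<lambda>x t. hub (x t)"])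
    fix x y t assume xy: "x \<in> tracks True" "y \<in> tracks True" and t: "t < T"
      and eq: "restrict (\<lambda>t. reduce 1 (x t)) {0..<int T} = restrict (\<lambda>t. reduce 1 (y t)) {0..<int T}"
    have "side (x (int t)) = side (y (int t))" using words_eq_reduce[OF eq t] side_reduce by metis
    then have "hub (x (int t)) = hub (y (int t))" by (simp add: hub_def)
    then show "(1/3) ^ N * sym_dist A (\<lambda>t. hub (x t)) y (int t) < \<delta>"
      by (intro near_of_half[OF _ N(1)] sym_dist_hub_le_half[OF A xy(2)])
  qed (auto intro: hub_tracks)
  then show "span_size A True T \<delta> \<le> word_bound N T * (T + 1) ^ 4" by simp
qed

text \<open>In a window that sees at most one side, the visible part may be replaced by hubs with stars outside:
an interval of one-sided digits, which is a track even if blocks contain no hubs.\<close>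

lemma span_size_le_one_sided:
  assumes A: "hub_isolated A" and T: "0 < T"
    and b: "\<And>a. a \<in> levels \<Longrightarrow> 2 * a < T \<Longrightarrow> a \<le> b"
  shows "span_size A h T ((1/3) ^ N) \<le> word_bound N T * ((T + 1) ^ 4 * ((b + 2) * 6 ^ (12 * b)))"
proof -
  \<comment> \<open>A window with both sides keeps its track; its full word is part of the code.\<close>
  define s where "s x = (if two_sided T x then x else (\<lambda>t. if t \<in> {0..<int T} then hub (x t) else 0))"
    for x :: "int \<Rightarrow> nat"
  have s_tracks: "s x \<in> tracks h" if x: "x \<in> tracks h" for x
  proof (cases "two_sided T x")
    case True
    then show ?thesis using x by (simp add: s_def)
  next
    case False
    have side_s: "side (s x t) = (if t \<in> {0..<int T} then side (x t) else 0)" for t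
      using False by (simp add: s_def side_hub)
    show ?thesis
    proof (rule tracksI_one_sided)
      show "s x t \<in> symbols" for t
        using False hub_symbol[of "x t"] by (auto simp: s_def symbols_def)
      show "side (s x j) = side (s x i)"
        if "i \<le> j" "j \<le> k" "side (s x i) = side (s x k)" "side (s x i) \<noteq> 0" for i j k
        using that tracks_convex[OF x, of i j k] by (auto simp: side_s split: if_splits)
      show False if "side (s x i) = 1" "side (s x j) = 2" for i j
      proof -
        have "i \<in> {0..<int T}" "j \<in> {0..<int T}" "side (x i) = 1" "side (x j) = 2"
          using that by (auto simp: side_s split: if_splits)
        then show False using False unfolding two_sided_def by blast
      qed
    qed
  qed
  show ?thesis
  proof (rule span_size_le_code_count[OF A T _ card_mixed_words, where s=s])
    show "(1/3::real) ^ Suc N < (1/3) ^ N" by simp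
    fix x y t assume xy: "x \<in> tracks h" "y \<in> tracks h" "mixed_word T x = mixed_word T y" and t: "t < T"
    have tw: "int t \<in> {0..<int T}" using t by simp
    have "sym_dist A (s x) y (int t) \<le> 1/2"
    proof (cases "two_sided T x")
      case True
      then have "s x (int t) = y (int t)" using mixed_word_eq[OF xy(3) True tw] by (simp add: s_def)
      then show ?thesis by (simp add: sym_dist_same)
    next
      case False
      have "hub (x (int t)) = hub (y (int t))" using mixed_word_side[OF xy(3) tw] by (simp add: hub_def)
      then show ?thesis using False tw by (intro sym_dist_hub_le_half[OF A xy(2)]) (simp add: s_def)
    qed
    then show "(1/3) ^ N * sym_dist A (s x) y (int t) < (1/3) ^ N"
      by (rule near_of_half) simp
  qed (use b s_tracks in auto)
qed

section \<open>Separated sets of one-sided words\<close>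

lemma sym_dist_ge_1D:
  assumes "1 \<le> sym_dist A x y t" "side (x t) = side (y t)"
  shows "x t \<noteq> y t" "A (side (x t)) (dig (x t)) (dig (y t))"
    "side (x t) = 1 \<Longrightarrow> i < t \<Longrightarrow> x i = y i" "side (x t) \<noteq> 1 \<Longrightarrow> t < i \<Longrightarrow> x i = y i"
proof -
  show ne: "x t \<noteq> y t" using assms by (auto simp: sym_dist_def)
  show "A (side (x t)) (dig (x t)) (dig (y t))" using assms ne by (auto simp: sym_dist_def split: if_splits)
  have "tail_gap (dir (x t)) x y t \<le> 0" using assms ne by (auto simp: sym_dist_def split: if_splits)
  then have eq: "x (t + dir (x t) * int (Suc r)) = y (t + dir (x t) * int (Suc r))" for r
    using tail_gap_nonneg[of "dir (x t)" x y t] tail_gap_eq_0_iff[of "dir (x t)" x y t] by simp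
  show "x i = y i" if "side (x t) = 1" "i < t"
    using eq[of "nat (t - i - 1)"] that by (simp add: dir_def)
  show "x i = y i" if "side (x t) \<noteq> 1" "t < i"
    using eq[of "nat (i - t - 1)"] that by (simp add: dir_def)
qed

lemma sym_dist_eq_1I:
  assumes "x t \<noteq> y t" "A (side (x t)) (dig (x t)) (dig (y t))"
    "\<And>i. side (x t) = 1 \<Longrightarrow> i < t \<Longrightarrow> x i = y i" "\<And>i. side (x t) \<noteq> 1 \<Longrightarrow> t < i \<Longrightarrow> x i = y i"
  shows "sym_dist A x y t = 1"
proof -
  have "tail_gap (dir (x t)) x y t = 0"
    unfolding tail_gap_eq_0_iff
  proof
    fix r
    show "x (t + dir (x t) * int (Suc r)) = y (t + dir (x t) * int (Suc r))"
    proof (cases "side (x t) = 1")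
      case True
      then show ?thesis by (intro assms(3)) (simp_all add: dir_def)
    next
      case False
      then show ?thesis by (intro assms(4)) (simp_all add: dir_def)
    qed
  qed
  then show ?thesis using assms(1,2) by (auto simp: sym_dist_def)
qed

lemma card_le_2_of_triangle_free:
  assumes fin: "finite V" and R: "\<And>u v. u \<in> V \<Longrightarrow> v \<in> V \<Longrightarrow> u \<noteq> v \<Longrightarrow> R u v"
    and tf: "\<And>u v w. R u v \<Longrightarrow> R v w \<Longrightarrow> R u w \<Longrightarrow> False"
  shows "card V \<le> 2"
proof (rule ccontr)
  assume "\<not> card V \<le> 2"
  then have "3 \<le> card V" by simp
  then obtain S where S: "S \<subseteq> V" "card S = 3" by (rule obtain_subset_with_card_n)
  then obtain u v w where "S = {u, v, w}" "u \<noteq> v" "v \<noteq> w" "u \<noteq> w" unfolding card_3_iff by blast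
  with S(1) show False using R tf[of u v w] by auto
qed

text \<open>Induction on the length of the window: at its first time, the symbols form a clique in a triangle-free
graph, so there are at most two of them, and words with the same symbol there differ later.\<close>

lemma card_first_difference_clique:
  fixes K :: "(int \<Rightarrow> 'b) set"
  assumes tf: "\<And>u v w. R u v \<Longrightarrow> R v w \<Longrightarrow> R u w \<Longrightarrow> False"
    and "finite K"
    and "\<And>x y. x \<in> K \<Longrightarrow> y \<in> K \<Longrightarrow> x \<noteq> y \<Longrightarrow> \<exists>t\<in>{s..<s + int n}. R (x t) (y t) \<and> (\<forall>i<t. x i = y i)"
  shows "card K \<le> 2 ^ n"
  using assms(2,3)
proof (induction n arbitrary: s K)
  case 0
  have "card K \<le> 1" by (rule card_le_1_of_all_equal[OF 0(1)]) (use 0(2) in auto)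
  then show ?case by simp
next
  case (Suc n)
  let ?V = "(\<lambda>x. x s) ` K"
  have "card K \<le> card ?V * 2 ^ n"
  proof (rule card_le_fibres[OF Suc.prems(1) _ order_refl])
    fix v
    let ?F = "{x \<in> K. x s = v}"
    show "card ?F \<le> 2 ^ n"
    proof (rule Suc.IH[of ?F "s + 1"])
      fix x y assume xy: "x \<in> ?F" "y \<in> ?F" "x \<noteq> y"
      then obtain t where t: "t \<in> {s..<s + int (Suc n)}" "R (x t) (y t)" "\<forall>i<t. x i = y i"
        using Suc.prems(2)[of x y] by auto
      \<comment> \<open>A triangle-free relation has no loops: take the three vertices equal.\<close>
      have "t \<noteq> s" using t(2) xy tf[of v v v] by auto
      then show "\<exists>t\<in>{s + 1..<s + 1 + int n}. R (x t) (y t) \<and> (\<forall>i<t. x i = y i)"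
        using t by (intro bexI[of _ t]) auto
    qed (use Suc.prems(1) in simp)
  qed (use Suc.prems(1) in simp)
  also have "card ?V \<le> 2"
  proof (rule card_le_2_of_triangle_free[of ?V R])
    fix u v assume "u \<in> ?V" "v \<in> ?V" "u \<noteq> v"
    then obtain x y where xy: "x \<in> K" "y \<in> K" "u = x s" "v = y s" "x \<noteq> y" by blast
    then obtain t where t: "t \<in> {s..<s + int (Suc n)}" "R (x t) (y t)" "\<forall>i<t. x i = y i"
      using Suc.prems(2)[of x y] by blast
    have "\<not> s < t" using t(3) xy \<open>u \<noteq> v\<close> by auto
    then have "t = s" using t(1) by simp
    then show "R u v" using t(2) xy by simp
  qed (use Suc.prems(1) tf in blast)+
  finally show ?case by simp
qed

definition triangle_free :: "digit_graph \<Rightarrow> bool" where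
  "triangle_free A \<longleftrightarrow> (\<forall>s u v w. \<not> (A s u v \<and> A s v w \<and> A s u w))"

text \<open>Right digits reduce to left digits by reversing time.\<close>

lemma card_one_sided_clique:
  assumes A: "triangle_free A" and fin: "finite K" and s: "s = 1 \<or> s = 2"
    and far: "\<And>x y. x \<in> K \<Longrightarrow> y \<in> K \<Longrightarrow> x \<noteq> y \<Longrightarrow>
      \<exists>t<T. side (x (int t)) = s \<and> side (y (int t)) = s \<and> 1 \<le> sym_dist A x y (int t)"
  shows "card K \<le> 2 ^ T"
  using s
proof
  assume s: "s = 1"
  show ?thesis
  proof (rule card_first_difference_clique[where R="\<lambda>u v. A s (dig u) (dig v)" and s=0])
    show "\<exists>t\<in>{0..<0 + int T}. A s (dig (x t)) (dig (y t)) \<and> (\<forall>i<t. x i = y i)"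
      if xy: "x \<in> K" "y \<in> K" "x \<noteq> y" for x y
    proof -
      obtain t where t: "t < T" "side (x (int t)) = s" "side (y (int t)) = s" "1 \<le> sym_dist A x y (int t)"
        using far[OF xy] by blast
      then have side: "side (x (int t)) = side (y (int t))" by simp
      have "A s (dig (x (int t))) (dig (y (int t)))" using sym_dist_ge_1D(2)[OF t(4) side] t(2) by simp
      moreover have "x i = y i" if "i < int t" for i
        using sym_dist_ge_1D(3)[OF t(4) side _ that] t(2) s by simp
      ultimately show ?thesis using t(1) by (intro bexI[of _ "int t"]) simp_all
    qed
  qed (use A fin in \<open>auto simp: triangle_free_def\<close>)
next
  assume s: "s = 2"
  let ?r = "\<lambda>(x :: int \<Rightarrow> nat) i. x (- i)"
  have inj: "inj_on ?r K"
  proof (rule inj_onI, rule ext)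
    fix x y i assume "?r x = ?r y"
    from fun_cong[OF this, of "- i"] show "x i = y i" by simp
  qed
  have "card (?r ` K) \<le> 2 ^ T"
  proof (rule card_first_difference_clique[where R="\<lambda>u v. A s (dig u) (dig v)" and s="1 - int T"])
    show "\<exists>t\<in>{1 - int T..<1 - int T + int T}. A s (dig (x' t)) (dig (y' t)) \<and> (\<forall>i<t. x' i = y' i)"
      if xy': "x' \<in> ?r ` K" "y' \<in> ?r ` K" "x' \<noteq> y'" for x' y'
    proof -
      obtain x y where xy: "x \<in> K" "y \<in> K" "x \<noteq> y" "x' = ?r x" "y' = ?r y" using xy' by blast
      obtain t where t: "t < T" "side (x (int t)) = s" "side (y (int t)) = s" "1 \<le> sym_dist A x y (int t)"
        using far[OF xy(1-3)] by blast
      then have side: "side (x (int t)) = side (y (int t))" by simp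
      have "A s (dig (x (int t))) (dig (y (int t)))" using sym_dist_ge_1D(2)[OF t(4) side] t(2) by simp
      moreover have "x (- i) = y (- i)" if "i < - int t" for i
        using sym_dist_ge_1D(4)[OF t(4) side, of "- i"] that t(2) s by simp
      ultimately show ?thesis using t(1) by (intro bexI[of _ "- int t"]) (simp_all add: xy)
    qed
  qed (use A fin in \<open>auto simp: triangle_free_def\<close>)
  then show ?thesis by (simp add: card_image[OF inj])
qed

text \<open>Words on windows with both sides are determined by the code; on all other windows the tracks in \<open>K\<close>
show digits of one common side.\<close>

lemma card_mixed_word_fibre:
  assumes A: "triangle_free A"
    and K: "K \<subseteq> tracks h" "finite K" "\<And>x. x \<in> K \<Longrightarrow> mixed_word T x = c"
    and far: "\<And>x y. x \<in> K \<Longrightarrow> y \<in> K \<Longrightarrow> x \<noteq> y \<Longrightarrow> \<exists>t<T. 1 \<le> sym_dist A x y (int t)"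
  shows "card K \<le> 2 ^ T"
proof (cases "\<exists>x\<in>K. two_sided T x")
  case True
  then obtain z where z: "z \<in> K" "two_sided T z" by blast
  have "card K \<le> 1"
  proof (rule card_le_1_of_all_equal[OF K(2)])
    fix x y assume xy: "x \<in> K" "y \<in> K" "x \<noteq> y"
    then obtain t where t: "t < T" "1 \<le> sym_dist A x y (int t)" using far by blast
    have "z (int t) = x (int t)" "z (int t) = y (int t)"
      using t K(3) z xy by (auto intro!: mixed_word_eq)
    then show False using t(2) by (simp add: sym_dist_same)
  qed
  also have "(1::nat) \<le> 2 ^ T" by simp
  finally show ?thesis .
next
  case False
  define s :: nat where "s = (if \<exists>x\<in>K. \<exists>t\<in>{0..<int T}. side (x t) = 1 then 1 else 2)"
  have same: "side (x t) = side (y t)" if "x \<in> K" "y \<in> K" "t \<in> {0..<int T}" for x y t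
    using mixed_word_side[of T x y t] K(3) that by simp
  have s: "side (x t) = s" if x: "x \<in> K" and t: "t \<in> {0..<int T}" and nz: "side (x t) \<noteq> 0" for x t
  proof (cases "\<exists>x\<in>K. \<exists>t\<in>{0..<int T}. side (x t) = 1")
    case True
    then obtain z i where "z \<in> K" "i \<in> {0..<int T}" "side (z i) = 1" by blast
    then have "i \<in> {0..<int T}" "side (x i) = 1" using same[OF x] by auto
    then have "side (x t) \<noteq> 2" using False x t by (auto simp: two_sided_def)
    moreover have "side (x t) < 3" by simp
    ultimately show ?thesis using nz True by (simp add: s_def)
  next
    case False
    then have "side (x t) \<noteq> 1" using x t by blast
    moreover have "side (x t) < 3" by simp
    ultimately have "side (x t) = 2" using nz by linarith
    then show ?thesis using False by (simp add: s_def)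
  qed
  show ?thesis
  proof (rule card_one_sided_clique[OF A K(2), of s])
    show "s = 1 \<or> s = 2" by (simp add: s_def)
    fix x y assume xy: "x \<in> K" "y \<in> K" "x \<noteq> y"
    obtain t where t: "t < T" "1 \<le> sym_dist A x y (int t)" using far[OF xy] by blast
    have tw: "int t \<in> {0..<int T}" using t by simp
    have eq: "side (x (int t)) = side (y (int t))" by (rule same[OF xy(1,2) tw])
    have "x (int t) \<in> symbols" "y (int t) \<in> symbols" using xy K(1) tracks_symbol by blast+
    then have "side (x (int t)) \<noteq> 0"
      using sym_dist_ge_1D(1)[OF t(2) eq] eq by (auto simp: symbols_def)
    then have "side (x (int t)) = s" by (rule s[OF xy(1) tw])
    then show "\<exists>t<T. side (x (int t)) = s \<and> side (y (int t)) = s \<and> 1 \<le> sym_dist A x y (int t)"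
      using t eq by auto
  qed
qed

lemma sep_size_triangle_free_le:
  assumes A: "hub_isolated A" "triangle_free A" and T: "0 < T"
    and b: "\<And>a. a \<in> levels \<Longrightarrow> 2 * a < T \<Longrightarrow> a \<le> b"
  shows "sep_size A h T ((1/3) ^ N) \<le> word_bound N T * ((T + 1) ^ 4 * ((b + 2) * 6 ^ (12 * b))) * 2 ^ T"
proof (rule sep_num_le, rule card_separated_le[OF A(1) T _ card_mixed_words])
  show "(1/3::real) ^ Suc N < (1/3) ^ N" by simp
  fix K c
  assume K: "K \<subseteq> tracks h" "finite K" "\<And>x. x \<in> K \<Longrightarrow> mixed_word T x = c"
    and far: "\<And>x y. x \<in> K \<Longrightarrow> y \<in> K \<Longrightarrow> x \<noteq> y \<Longrightarrow> \<exists>t<T. (1/3) ^ N \<le> (1/3) ^ N * sym_dist A x y (int t)"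
  show "card K \<le> 2 ^ T"
  proof (rule card_mixed_word_fibre[OF A(2) K])
    fix x y assume "x \<in> K" "y \<in> K" "x \<noteq> y"
    from far[OF this] show "\<exists>t<T. 1 \<le> sym_dist A x y (int t)" by simp
  qed
qed (use b in auto)

section \<open>Separation in complete digit graphs\<close>

text \<open>If all ordinary left digits are adjacent, then lines of ordinary digits with a common past are
separated at their first difference. Conversely, a hub is never separated from another digit of its
side at distances above \<open>1/2\<close>, so merging it with digit 0 loses nothing at the scale \<open>\<delta>\<close>. The case \<open>q = 1\<close> is
that of \<open>\<delta>\<close> above the weight of track \<open>N\<close>, where this track is invisible.\<close>

lemma sep_size_complete_bounds:
  assumes A: "hub_isolated A" and complete: "\<And>d d'. d < 5 \<Longrightarrow> d' < 5 \<Longrightarrow> d \<noteq> d' \<Longrightarrow> A 1 d d'"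
    and T: "0 < T"
    and N: "(1/3) ^ N / 2 < \<delta>" "\<And>m. m < N \<Longrightarrow> \<delta> \<le> (1/3) ^ m / 2"
    and q: "q = (if \<delta> \<le> (1/3) ^ N then 5 else 1)"
  shows "(6 ^ T) ^ N * q ^ T \<le> sep_size A h T \<delta>" "sep_size A h T \<delta> \<le> word_bound N T * ((T + 1) ^ 4 * q ^ T)"
proof -
  have pos: "0 < (1/3::real) ^ N" by simp
  have "(1/3::real) ^ Suc N = (1/3) ^ N / 3" by simp
  then have \<delta>: "0 < \<delta>" "(1/3) ^ Suc N < \<delta>" using pos N(1) by linarith+
  have q0: "0 < q" "q \<le> 6" "q \<le> 5" using q by auto
  have "(6 ^ T) ^ N * card (lines T q) \<le> sep_size A h T \<delta>"
  proof (rule family_card_le_sep_size[OF A T \<delta>(1) N(2)])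
    fix x y assume x: "x \<in> lines T q" and y: "y \<in> lines T q" and ne: "x \<noteq> y"
    define P where "P i \<longleftrightarrow> x (int i) \<noteq> y (int i)" for i
    have out: "x t = y t" if "t < 0 \<or> int T \<le> t" for t
      using lines_outside[OF x that] lines_outside[OF y that] by simp
    obtain t where "x t \<noteq> y t" using ne by blast
    moreover from this have "0 \<le> t" using out[of t] by linarith
    ultimately have "P (nat t)" by (simp add: P_def)
    define i where "i = (LEAST i. P i)"
    have i: "P i" unfolding i_def by (rule LeastI[of P, OF \<open>P (nat t)\<close>])
    then have iT: "i < T" using out[of "int i"] by (force simp: P_def)
    have before: "x j = y j" if "j < int i" for j
    proof (cases "j < 0")
      case False
      then have "nat j < i" using that by simp
      then have "\<not> P (nat j)" unfolding i_def by (rule not_less_Least)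
      then show ?thesis using False by (simp add: P_def)
    qed (use out in blast)
    have dx: "dig (x (int i)) < q" "dig (y (int i)) < q" using lines_dig[OF x] lines_dig[OF y] q0 by auto
    have "x (int i) = 3 * dig (x (int i)) + 1" "y (int i) = 3 * dig (y (int i)) + 1"
      using lines_side[OF x, of "int i"] lines_side[OF y, of "int i"] by presburger+
    then have dne: "dig (x (int i)) \<noteq> dig (y (int i))" using i by (auto simp: P_def)
    have "sym_dist A x y (int i) = 1"
    proof (rule sym_dist_eq_1I)
      show "A (side (x (int i))) (dig (x (int i))) (dig (y (int i)))"
        using complete dx dne q0 lines_side[OF x] by auto
    qed (use i before lines_side[OF x] in \<open>auto simp: P_def\<close>)
    moreover have "\<delta> \<le> (1/3) ^ N" using q dx dne by (auto split: if_splits)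
    ultimately show "\<exists>t<T. \<delta> \<le> (1/3) ^ N * sym_dist A x y (int t)" using iT by auto
  qed (use lines_subset_tracks q0 card_lines in auto)
  then show "(6 ^ T) ^ N * q ^ T \<le> sep_size A h T \<delta>" by (simp add: card_lines)
  show "sep_size A h T \<delta> \<le> word_bound N T * ((T + 1) ^ 4 * q ^ T)"
  proof (rule sep_num_le, rule card_separated_le_code_count[OF A T \<delta>(2) words_card_bound[OF q0(1)]])
    fix x y t assume xy: "x \<in> tracks h" "y \<in> tracks h" and t: "t < T"
      and eq: "restrict (\<lambda>t. reduce q (x t)) {0..<int T} = restrict (\<lambda>t. reduce q (y t)) {0..<int T}"
    have red: "reduce q (x (int t)) = reduce q (y (int t))" by (rule words_eq_reduce[OF eq t])
    then have side: "side (x (int t)) = side (y (int t))" by (metis side_reduce)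
    show "(1/3) ^ N * sym_dist A x y (int t) < \<delta>"
    proof (cases "\<delta> \<le> (1/3) ^ N")
      case False
      have "(1/3) ^ N * sym_dist A x y (int t) \<le> (1/3) ^ N" by (rule mult_left_le[OF sym_dist_le_1]) simp
      then show ?thesis using False by linarith
    next
      case True
      then have q5: "q = 5" using q by simp
      have "sym_dist A x y (int t) \<le> 1/2"
      proof (rule sym_dist_le_half, rule side, rule notI)
        assume ne: "x (int t) \<noteq> y (int t)"
          and "A (side (x (int t))) (dig (x (int t))) (dig (y (int t)))"
        then have d: "dig (x (int t)) < 5" "dig (y (int t)) < 5" using A by (auto simp: hub_isolated_def)
        then have "dig (x (int t)) = dig (y (int t))" using red side by (simp add: reduce_def q5)
        with side ne show False by (metis mult_div_mod_eq)
      qed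
      then show ?thesis by (rule near_of_half[OF _ N(1)])
    qed
  qed auto
qed

section \<open>Words of a whole block\<close>

text \<open>Blocks around \<open>13 a\<close> without hubs. They start at time 0 and lie within the first \<open>27 a\<close> times.\<close>

definition block_words :: "nat \<Rightarrow> (int \<Rightarrow> nat) set" where
  "block_words a =
     (\<lambda>g t. if 0 \<le> t \<and> t < 12 * int a then 3 * g t + 1
            else if 14 * int a < t \<and> t \<le> 26 * int a then 3 * g (26 * int a - t) + 2 else 0) `
     ({0..<12 * int a} \<rightarrow>\<^sub>E {..<5})"

lemma card_block_words: "finite (block_words a)" "card (block_words a) = 5 ^ (12 * a)"
proof -
  let ?w = "\<lambda>(g :: int \<Rightarrow> nat) t. if 0 \<le> t \<and> t < 12 * int a then 3 * g t + 1
            else if 14 * int a < t \<and> t \<le> 26 * int a then 3 * g (26 * int a - t) + 2 else 0"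
  have "inj_on ?w ({0..<12 * int a} \<rightarrow>\<^sub>E {..<5})"
  proof (rule inj_onI)
    fix g g' assume g: "g \<in> {0..<12 * int a} \<rightarrow>\<^sub>E {..<5}" "g' \<in> {0..<12 * int a} \<rightarrow>\<^sub>E {..<5}" "?w g = ?w g'"
    show "g = g'"
    proof (rule PiE_ext[OF g(1,2)])
      fix t assume "t \<in> {0..<12 * int a}"
      with fun_cong[OF g(3), of t] show "g t = g' t" by simp
    qed
  qed
  moreover have "nat (12 * int a) = 12 * a" by simp
  ultimately show "card (block_words a) = 5 ^ (12 * a)"
    unfolding block_words_def by (simp add: card_image card_PiE)
  show "finite (block_words a)" unfolding block_words_def by (intro finite_imageI finite_PiE) auto
qed

lemma block_words_block:
  assumes "x \<in> block_words a"
  shows "x \<in> block h a (13 * int a)" "x t \<in> symbols"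
proof -
  obtain g where g: "g \<in> {0..<12 * int a} \<rightarrow>\<^sub>E {..<5}"
    and x: "x = (\<lambda>t. if 0 \<le> t \<and> t < 12 * int a then 3 * g t + 1
            else if 14 * int a < t \<and> t \<le> 26 * int a then 3 * g (26 * int a - t) + 2 else 0)"
    using assms by (auto simp: block_words_def)
  have g5: "g t < 5" if "0 \<le> t" "t < 12 * int a" for t using that PiE_mem[OF g, of t] by simp
  have dig: "dig (x t) < 5" for t using g5[of t] g5[of "26 * int a - t"] by (auto simp: x)
  have "x (13 * int a + j) = Suc (x (13 * int a - j))" if "int a < j" "j \<le> 13 * int a" for j
    using that by (simp add: x)
  moreover have "side (Suc (Suc (3 * k))) = 2" for k by presburger
  then have "side (x t) = (if 13 * int a - 13 * int a \<le> t \<and> t < 13 * int a - int a then 1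
      else if 13 * int a + int a < t \<and> t \<le> 13 * int a + 13 * int a then 2 else 0)" for t
    by (simp add: x)
  moreover have "dig (x t) \<noteq> 5" for t using dig[of t] by simp
  ultimately show "x \<in> block h a (13 * int a)" by (simp add: block_def)
  have "side (3 * k + 1) \<noteq> 0" "side (3 * k + 2) \<noteq> 0" for k :: nat by presburger+
  then have "x t = 0 \<or> side (x t) \<noteq> 0" unfolding x by (simp only: split: if_splits) blast
  then show "x t \<in> symbols" using dig[of t] by (auto simp: symbols_def)
qed

lemma block_words_tracks: "a \<in> levels \<Longrightarrow> block_words a \<subseteq> tracks h"
  using tracksI_block block_words_block by blast

lemma levels_pos: "a \<in> levels \<Longrightarrow> 0 < a"
  by (auto simp: levels_def)

text \<open>The pattern of sides on a window containing a block shows both ends of its gap, hence its level and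
its centre.\<close>

lemma block_aligned:
  assumes a: "0 < a" and x: "x \<in> block h a' c" and y: "y \<in> block h' a (13 * int a)"
    and sides: "\<And>t. 0 \<le> t \<Longrightarrow> t < 27 * int a \<Longrightarrow> side (x t) = side (y t)"
  shows "a' = a" "c = 13 * int a"
proof -
  have L: "c - 13 * int a' \<le> t \<and> t < c - int a' \<longleftrightarrow> 0 \<le> t \<and> t < 12 * int a"
    if "0 \<le> t" "t < 27 * int a" for t
    using block_left_iff[OF x, of t] block_left_iff[OF y, of t] sides[OF that] by simp
  have R: "c + int a' < t \<and> t \<le> c + 13 * int a' \<longleftrightarrow> 14 * int a < t \<and> t \<le> 26 * int a"
    if "0 \<le> t" "t < 27 * int a" for t
    using block_right_iff[OF x, of t] block_right_iff[OF y, of t] sides[OF that] by simp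
  \<comment> \<open>Compare the two patterns at the outer end of each side and at the two ends of the gap.\<close>
  have "c - 13 * int a' \<le> 0" "12 * int a - 1 < c - int a'" "c - int a' \<le> 12 * int a"
    using L[of 0] L[of "12 * int a - 1"] L[of "12 * int a"] a by auto
  moreover have "26 * int a \<le> c + 13 * int a'" "c + int a' < 14 * int a + 1" "14 * int a \<le> c + int a'"
    using R[of "26 * int a"] R[of "14 * int a + 1"] R[of "14 * int a"] a by auto
  ultimately show "a' = a" "c = 13 * int a" by linarith+
qed

text \<open>Two distinct ordinary digits are adjacent on at least one of the sides.\<close>

definition covering :: "digit_graph \<Rightarrow> bool" where
  "covering A \<longleftrightarrow> (\<forall>d d'. d < 5 \<and> d' < 5 \<and> d \<noteq> d' \<longrightarrow> A 1 d d' \<or> A 2 d d')"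

text \<open>A track close to a block word has the same sides and is therefore an aligned block. At the first
difference \<open>i\<close> the whole past agrees; by the mirror symmetry the whole future agrees at the mirror
position of \<open>i\<close>. The digits are the same pair at both positions, and they are adjacent on one side.\<close>

lemma block_close_imp_eq:
  assumes A: "covering A" and a: "0 < a"
    and x: "x \<in> tracks False" and y: "y \<in> block_words a"
    and close: "\<And>t. t < 27 * a \<Longrightarrow> sym_dist A x y (int t) < 1"
  shows "x = y"
proof (rule ccontr)
  assume ne: "x \<noteq> y"
  have close': "sym_dist A x y t < 1" if "0 \<le> t" "t < 27 * int a" for t
    using close[of "nat t"] that by (simp add: nat_less_iff)
  have sides: "side (x t) = side (y t)" if "0 \<le> t" "t < 27 * int a" for t
    using close'[OF that] by (auto simp: sym_dist_def split: if_splits)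
  note yb = block_words_block(1)[OF y, of False]
  have "side (y 0) = 1" "side (y (26 * int a)) = 2"
    using a block_left_iff[OF yb, of 0] block_right_iff[OF yb, of "26 * int a"] by simp_all
  then have "side (x 0) = 1" "side (x (26 * int a)) = 2" using a sides by simp_all
  then obtain a' c where "x \<in> block False a' c" by (rule tracks_block[OF x])
  then have xb: "x \<in> block False a (13 * int a)" using block_aligned[OF a _ yb sides] by blast
  have nohub: "dig (x t) \<noteq> 5" "dig (y t) \<noteq> 5" for t
    using xb yb unfolding block_def mem_Collect_eq by blast+
  have star: "x t = y t" if "\<not> (0 \<le> t \<and> t < 12 * int a)" "\<not> (14 * int a < t \<and> t \<le> 26 * int a)" for t
  proof -
    have "side (x t) = 0" "side (y t) = 0"
      using that block_side[OF xb, of t] block_side[OF yb, of t] by auto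
    then show ?thesis using tracks_symbol[OF x, of t] block_words_block(2)[OF y, of t]
      by (auto simp: symbols_def)
  qed
  have mirror: "x (26 * int a - t) = Suc (x t)" "y (26 * int a - t) = Suc (y t)"
    if "0 \<le> t" "t < 12 * int a" for t
    using block_mirror[OF xb, of "13 * int a - t"] block_mirror[OF yb, of "13 * int a - t"] that by simp_all
  define P where "P i \<longleftrightarrow> i < 12 * a \<and> x (int i) \<noteq> y (int i)" for i
  have "\<exists>i. P i"
  proof (rule ccontr)
    assume "\<not> (\<exists>i. P i)"
    then have none: "\<not> P i" for i by blast
    have left: "x t = y t" if "0 \<le> t" "t < 12 * int a" for t
      using none[of "nat t"] that by (simp add: P_def nat_less_iff)
    have "x t = y t" for t
    proof (cases "14 * int a < t \<and> t \<le> 26 * int a")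
      case True
      then show ?thesis using mirror[of "26 * int a - t"] left[of "26 * int a - t"] by simp
    next
      case False
      then show ?thesis using left[of t] star[of t] by blast
    qed
    then show False using ne by blast
  qed
  then obtain i0 where "P i0" ..
  define i where "i = (LEAST i. P i)"
  have i: "i < 12 * a" "x (int i) \<noteq> y (int i)"
    using LeastI[of P, OF \<open>P i0\<close>] by (simp_all add: i_def P_def)
  have least: "x t = y t" if "0 \<le> t" "t < int i" for t
  proof -
    have "nat t < i" using that by linarith
    then have "\<not> P (nat t)" unfolding i_def by (rule not_less_Least)
    then show ?thesis using that i(1) by (simp add: P_def)
  qed
  have before: "x t = y t" if "t < int i" for t
    using least[of t] star[of t] that i(1) by (cases "0 \<le> t") auto
  have after: "x t = y t" if "26 * int a - int i < t" for t
  proof (cases "t \<le> 26 * int a")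
    case True
    have "x (26 * int a - (26 * int a - t)) = y (26 * int a - (26 * int a - t))"
      using mirror[of "26 * int a - t"] least[of "26 * int a - t"] True that i(1) by simp
    then show ?thesis by simp
  next
    case False
    then show ?thesis using star[of t] by simp
  qed
  let ?d = "dig (x (int i))" and ?e = "dig (y (int i))"
  have s1: "side (x (int i)) = 1" "side (y (int i)) = 1"
    using i(1) block_left_iff[OF xb, of "int i"] block_left_iff[OF yb, of "int i"] by simp_all
  let ?r = "26 * int a - int i"
  have r: "x ?r = Suc (x (int i))" "y ?r = Suc (y (int i))" using mirror[of "int i"] i(1) by simp_all
  have s2: "side (x ?r) = 2" "dig (x ?r) = ?d" "dig (y ?r) = ?e"
    using s1 unfolding r by presburger+
  have "?d < 6" "?e < 6"
    using tracks_dig[OF x] block_words_block(2)[OF y, of "int i"] by (auto simp: symbols_def)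
  then have "?d < 5" "?e < 5" using nohub[of "int i"] by linarith+
  moreover have "?d \<noteq> ?e" using i(2) s1 by (metis mult_div_mod_eq)
  ultimately consider "A 1 ?d ?e" | "A 2 ?d ?e" using A unfolding covering_def by blast
  then show False
  proof cases
    case 1
    have "sym_dist A x y (int i) = 1"
    proof (rule sym_dist_eq_1I)
      show "A (side (x (int i))) ?d ?e" using 1 s1 by simp
    qed (use i(2) before s1 in simp_all)
    then show False using close'[of "int i"] i(1) by simp
  next
    case 2
    have "sym_dist A x y ?r = 1"
    proof (rule sym_dist_eq_1I)
      show "A (side (x ?r)) (dig (x ?r)) (dig (y ?r))" using 2 s2 by simp
      show "x ?r \<noteq> y ?r" using i(2) r by simp
    qed (use after s2 in simp_all)
    then show False using close'[of ?r] i(1) by simp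
  qed
qed

lemma third_power_le_half:
  assumes "m < N" shows "(1/3::real) ^ N \<le> (1/3) ^ m / 2"
proof -
  have "(1/3::real) ^ N \<le> (1/3) ^ Suc m" using assms by (intro power_decreasing) auto
  also have "\<dots> \<le> (1/3) ^ m / 2" by simp
  finally show ?thesis .
qed

lemma span_size_ge_blocks:
  assumes A: "hub_isolated A" "covering A" and a: "a \<in> levels"
  shows "(6 ^ (27 * a)) ^ N * 5 ^ (12 * a) \<le> span_size A False (27 * a) ((1/3) ^ N)"
proof -
  have "(6 ^ (27 * a)) ^ N * card (block_words a) \<le> span_size A False (27 * a) ((1/3) ^ N)"
  proof (rule family_card_le_span_size[OF A(1) _ _ third_power_le_half])
    fix s x y assume s: "s \<in> tracks False" and xy: "x \<in> block_words a" "y \<in> block_words a"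
      and cx: "\<And>t. t < 27 * a \<Longrightarrow> (1/3) ^ N * sym_dist A s x (int t) < (1/3) ^ N"
      and cy: "\<And>t. t < 27 * a \<Longrightarrow> (1/3) ^ N * sym_dist A s y (int t) < (1/3) ^ N"
    have "s = x" by (rule block_close_imp_eq[OF A(2) levels_pos[OF a] s xy(1)]) (use cx in simp)
    moreover have "s = y" by (rule block_close_imp_eq[OF A(2) levels_pos[OF a] s xy(2)]) (use cy in simp)
    ultimately show "x = y" by simp
  qed (use levels_pos[OF a] block_words_tracks[OF a] card_block_words in auto)
  then show ?thesis by (simp add: card_block_words)
qed

lemma sep_size_ge_blocks:
  assumes A: "hub_isolated A" "covering A" and a: "a \<in> levels"
  shows "(6 ^ (27 * a)) ^ N * 5 ^ (12 * a) \<le> sep_size A h (27 * a) ((1/3) ^ N)"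
proof -
  have "(6 ^ (27 * a)) ^ N * card (block_words a) \<le> sep_size A h (27 * a) ((1/3) ^ N)"
  proof (rule family_card_le_sep_size[OF A(1) _ _ third_power_le_half])
    fix x y assume xy: "x \<in> block_words a" "y \<in> block_words a" "x \<noteq> y"
    show "\<exists>t<27 * a. (1/3) ^ N \<le> (1/3) ^ N * sym_dist A x y (int t)"
    proof (rule ccontr)
      assume far: "\<not> ?thesis"
      have "x \<in> tracks False" using xy(1) block_words_tracks[OF a] by blast
      then have "x = y"
        by (rule block_close_imp_eq[OF A(2) levels_pos[OF a] _ xy(2)]) (use far in \<open>simp add: not_le\<close>)
      with xy(3) show False ..
    qed
  qed (use levels_pos[OF a] block_words_tracks[OF a] card_block_words in auto)
  then show ?thesis by (simp add: card_block_words)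
qed

section \<open>Growth rates\<close>

lemma ln_word_bound:
  "ln (real (word_bound N T)) = real N * (4 * ln (real T + real (2 * N + 2)) + (real T + real (2 * N + 1)) * ln 6)"
proof -
  have "real (word_bound N T) = ((real T + real (2 * N + 2)) ^ 4 * 6 ^ (T + 2 * N + 1)) ^ N"
    by (simp add: word_bound_def algebra_simps)
  also have "ln \<dots> = real N * (4 * ln (real T + real (2 * N + 2)) + (real T + real (2 * N + 1)) * ln 6)"
    by (simp add: ln_realpow ln_mult_pos algebra_simps)
  finally show ?thesis .
qed

lemma ln_add_over_tendsto_0: "(\<lambda>T::nat. ln (real T + c) / real T) \<longlonglongrightarrow> 0"
  by real_asymp

lemma word_bound_rate: "(\<lambda>T. ln (real (word_bound N T)) / real T) \<longlonglongrightarrow> real N * ln 6"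
proof -
  have "(\<lambda>T::nat. (real T + real (2 * N + 1)) / real T) \<longlonglongrightarrow> 1" by real_asymp
  then have "(\<lambda>T. real N * (4 * (ln (real T + real (2 * N + 2)) / real T) + (real T + real (2 * N + 1)) / real T * ln 6))
      \<longlonglongrightarrow> real N * (4 * 0 + 1 * ln 6)"
    by (intro tendsto_intros ln_add_over_tendsto_0)
  moreover have "n * (4 * L + S * l) / t = n * (4 * (L / t) + S / t * l)" for n L S l t :: real
    by (simp add: divide_inverse algebra_simps)
  ultimately show ?thesis unfolding ln_word_bound by simp
qed

text \<open>The polynomial factors and the bounded overhang of the windows do not affect the growth rate.\<close>

lemma rate_tendsto:
  fixes n :: "nat \<Rightarrow> nat"
  assumes q: "0 < q"
    and lower: "\<And>T. 0 < T \<Longrightarrow> (6 ^ T) ^ N * q ^ T \<le> n T"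
    and upper: "\<And>T. 0 < T \<Longrightarrow> n T \<le> word_bound N T * ((T + 1) ^ 4 * q ^ T)"
  shows "(\<lambda>T. ln (real (n T)) / real T) \<longlonglongrightarrow> real N * ln 6 + ln (real q)"
proof (rule tendsto_sandwich)
  have pos: "0 < (6 ^ T) ^ N * q ^ T" for T using q by simp
  let ?u = "\<lambda>T. ln (real (word_bound N T)) / real T + 4 * (ln (real T + 1) / real T) + ln (real q)"
  show "\<forall>\<^sub>F T in sequentially. real N * ln 6 + ln (real q) \<le> ln (real (n T)) / real T"
  proof (rule eventually_sequentiallyI[of 1])
    fix T :: nat assume T: "1 \<le> T"
    have "real T * (real N * ln 6 + ln (real q)) = ln (real ((6 ^ T) ^ N * q ^ T))"
      using q by (simp add: ln_mult_pos ln_realpow algebra_simps)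
    also have "\<dots> \<le> ln (real (n T))"
    proof (intro ln_mono of_nat_mono)
      show "(6 ^ T) ^ N * q ^ T \<le> n T" using lower T by simp
      show "0 < real ((6 ^ T) ^ N * q ^ T)" using pos[of T] by (simp only: of_nat_0_less_iff)
    qed
    finally show "real N * ln 6 + ln (real q) \<le> ln (real (n T)) / real T"
      using T by (simp add: pos_le_divide_eq mult.commute)
  qed
  show "\<forall>\<^sub>F T in sequentially. ln (real (n T)) / real T \<le> ?u T"
  proof (rule eventually_sequentiallyI[of 1])
    fix T :: nat assume T: "1 \<le> T"
    have pos: "0 < n T" using lower[of T] pos[of T] T by linarith
    have fc: "0 < word_bound N T" by (simp add: word_bound_def)
    have "ln (real (n T)) \<le> ln (real (word_bound N T * ((T + 1) ^ 4 * q ^ T)))"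
      using upper[of T] T pos by (intro ln_mono) (simp_all only: of_nat_le_iff of_nat_0_less_iff)
    also have "\<dots> = ln (real (word_bound N T)) + 4 * ln (real T + 1) + real T * ln (real q)"
      using q fc by (simp add: ln_mult_pos ln_realpow add.commute)
    finally have "ln (real (n T)) / real T \<le> (ln (real (word_bound N T)) + 4 * ln (real T + 1) + real T * ln (real q)) / real T"
      by (rule divide_right_mono) simp
    also have "\<dots> = ?u T" using T by (simp add: add_divide_distrib)
    finally show "ln (real (n T)) / real T \<le> ?u T" .
  qed
  have "?u \<longlonglongrightarrow> real N * ln 6 + 4 * 0 + ln (real q)"
    by (intro tendsto_intros word_bound_rate ln_add_over_tendsto_0)
  then show "?u \<longlonglongrightarrow> real N * ln 6 + ln (real q)" by simp
qed simp

lemma liminf_eq_limsup_of_rate: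
  assumes "(\<lambda>T. ln (real (n T)) / real T) \<longlonglongrightarrow> c"
  shows "liminf (\<lambda>T. ereal (ln (real (n T)) / real T)) = limsup (\<lambda>T. ereal (ln (real (n T)) / real T))"
proof -
  have "(\<lambda>T. ereal (ln (real (n T)) / real T)) \<longlonglongrightarrow> ereal c" using assms by simp
  then show ?thesis using lim_imp_Liminf lim_imp_Limsup trivial_limit_sequentially by metis
qed

lemma level_below_odd_factorial:
  assumes "a \<in> levels" "2 * a < fact (2 * k + 1)"
  shows "a \<le> fact (2 * k)"
proof -
  obtain i where a: "a = fact (2 * i)" using assms(1) by (auto simp: levels_def)
  have "i \<le> k"
  proof (rule ccontr)
    assume "\<not> i \<le> k"
    then have "(fact (2 * k + 1) :: nat) \<le> fact (2 * i)" by (intro fact_mono_nat) simp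
    then show False using assms(2) by (simp add: a)
  qed
  then show ?thesis unfolding a by (intro fact_mono_nat) simp
qed

text \<open>At \<open>T = (2k+1)!\<close> every level that fits into the window is at most \<open>b = (2k)!\<close>, and \<open>b/T = 1/(2k+1)\<close>
tends to 0, so the contribution of whole blocks vanishes.\<close>

lemma liminf_le_between_levels:
  fixes n :: "nat \<Rightarrow> nat"
  assumes c: "0 < c" and pos: "\<And>T. 0 < T \<Longrightarrow> 0 < n T"
    and upper: "\<And>T b. 0 < T \<Longrightarrow> (\<And>a. a \<in> levels \<Longrightarrow> 2 * a < T \<Longrightarrow> a \<le> b) \<Longrightarrow>
      n T \<le> word_bound N T * ((T + 1) ^ 4 * ((b + 2) * 6 ^ (12 * b))) * c ^ T"
  shows "liminf (\<lambda>T. ereal (ln (real (n T)) / real T)) \<le> ereal (real N * ln 6 + ln (real c))"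
proof -
  define r :: "nat \<Rightarrow> nat" where "r k = fact (2 * k + 1)" for k
  let ?f = "\<lambda>T. ereal (ln (real (n T)) / real T)"
  let ?g = "\<lambda>T. ln (real (word_bound N T)) / real T + 4 * (ln (real T + 1) / real T)"
  let ?u = "\<lambda>k. ?g (r k) + (3 + 12 * ln 6) * (1 / (2 * real k + 1)) + ln (real c)"
  have mono: "strict_mono r"
    unfolding r_def strict_mono_Suc_iff by (intro allI fact_less_mono_nat) auto
  have "?g \<longlonglongrightarrow> real N * ln 6 + 4 * 0"
    by (intro tendsto_intros word_bound_rate ln_add_over_tendsto_0)
  then have "(?g \<circ> r) \<longlonglongrightarrow> real N * ln 6 + 4 * 0" by (rule LIMSEQ_subseq_LIMSEQ[OF _ mono])
  then have g: "(\<lambda>k. ?g (r k)) \<longlonglongrightarrow> real N * ln 6 + 4 * 0" by (simp only: comp_def)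
  have k: "(\<lambda>k::nat. 1 / (2 * real k + 1)) \<longlonglongrightarrow> 0" by real_asymp
  have u: "?u \<longlonglongrightarrow> (real N * ln 6 + 4 * 0) + (3 + 12 * ln 6) * 0 + ln (real c)"
    by (intro tendsto_intros g k)
  have le: "ln (real (n (r k))) / real (r k) \<le> ?u k" for k
  proof -
    define b :: nat where "b = fact (2 * k)"
    have b: "1 \<le> b" unfolding b_def by (simp add: fact_ge_1)
    have rb: "real (r k) = (2 * real k + 1) * real b" by (simp add: r_def b_def algebra_simps)
    have T: "0 < r k" by (simp add: r_def)
    have fc: "0 < word_bound N (r k)" by (simp add: word_bound_def)
    have "n (r k) \<le> word_bound N (r k) * ((r k + 1) ^ 4 * ((b + 2) * 6 ^ (12 * b))) * c ^ r k"
      by (rule upper[OF T]) (unfold r_def b_def, rule level_below_odd_factorial)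
    then have "ln (real (n (r k))) \<le> ln (real (word_bound N (r k) * ((r k + 1) ^ 4 * ((b + 2) * 6 ^ (12 * b))) * c ^ r k))"
      using pos[OF T] by (intro ln_mono) (simp_all only: of_nat_le_iff of_nat_0_less_iff)
    also have "\<dots> = ln (real (word_bound N (r k)) * ((real (r k) + 1) ^ 4 * ((real b + 2) * 6 ^ (12 * b))) * real c ^ r k)"
      by (simp only: of_nat_mult of_nat_power of_nat_add of_nat_numeral of_nat_1)
    also have "\<dots> = ln (real (word_bound N (r k))) + 4 * ln (real (r k) + 1)
        + (ln (real b + 2) + 12 * real b * ln 6) + real (r k) * ln (real c)"
    proof -
      have "ln (F * (R ^ 4 * (B * 6 ^ (12 * b))) * C ^ T) = ln F + 4 * ln R + (ln B + 12 * real b * ln 6) + real T * ln C"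
        if "0 < F" "0 < R" "0 < B" "0 < C" for F R B C :: real and T
        using that by (simp add: ln_mult_pos ln_realpow)
      then show ?thesis using c fc by simp
    qed
    also have "\<dots> \<le> ln (real (word_bound N (r k))) + 4 * ln (real (r k) + 1)
        + (3 + 12 * ln 6) * real b + real (r k) * ln (real c)"
      using ln_le_minus_one[of "real b + 2"] b by (simp add: algebra_simps)
    finally have "ln (real (n (r k))) / real (r k) \<le> (ln (real (word_bound N (r k))) + 4 * ln (real (r k) + 1)
        + (3 + 12 * ln 6) * real b + real (r k) * ln (real c)) / real (r k)"
      by (rule divide_right_mono) simp
    also have "\<dots> = ?g (r k) + (3 + 12 * ln 6) * (real b / real (r k)) + ln (real c)"
      using T by (simp add: add_divide_distrib)
    also have "real b / real (r k) = 1 / (2 * real k + 1)"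
      using b by (simp add: rb)
    finally show ?thesis .
  qed
  have "liminf ?f \<le> liminf (?f \<circ> r)" by (rule liminf_subseq_mono[OF mono])
  also have "\<dots> \<le> liminf (\<lambda>k. ereal (?u k))"
    using le by (intro Liminf_mono always_eventually) simp
  also have "\<dots> = ereal (real N * ln 6 + ln (real c))"
    using u by (intro lim_imp_Liminf) simp_all
  finally show ?thesis .
qed

text \<open>At \<open>T = 27 a\<close> for a level \<open>a\<close>, a whole block fits into the window.\<close>

lemma limsup_ge_at_levels:
  fixes n :: "nat \<Rightarrow> nat"
  assumes lower: "\<And>a. a \<in> levels \<Longrightarrow> (6 ^ (27 * a)) ^ N * 5 ^ (12 * a) \<le> n (27 * a)"
  shows "ereal (real N * ln 6 + 4/9 * ln 5) \<le> limsup (\<lambda>T. ereal (ln (real (n T)) / real T))"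
proof -
  define r :: "nat \<Rightarrow> nat" where "r k = 27 * fact (2 * k)" for k
  let ?f = "\<lambda>T. ereal (ln (real (n T)) / real T)"
  have "(fact (2 * k) :: nat) < fact (2 * Suc k)" for k
    by (cases "k = 0") (auto intro!: fact_less_mono_nat simp del: fact_Suc)
  then have mono: "strict_mono r" unfolding r_def strict_mono_Suc_iff by simp
  have "ereal (real N * ln 6 + 4/9 * ln 5) \<le> ?f (r k)" for k
  proof -
    define a :: nat where "a = fact (2 * k)"
    have a: "0 < a" "a \<in> levels" by (auto simp: a_def levels_def)
    have "real (27 * a) * (real N * ln 6 + 4/9 * ln 5) = ln (real ((6 ^ (27 * a)) ^ N * 5 ^ (12 * a)))"
      by (simp add: ln_mult_pos ln_realpow algebra_simps)
    also have "\<dots> \<le> ln (real (n (27 * a)))"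
      using lower[OF a(2)] by (intro ln_mono) (simp_all only: of_nat_le_iff of_nat_0_less_iff, simp)
    finally have "real N * ln 6 + 4/9 * ln 5 \<le> ln (real (n (27 * a))) / real (27 * a)"
      using a(1) by (simp add: pos_le_divide_eq mult.commute)
    moreover have "r k = 27 * a" by (simp add: r_def a_def)
    ultimately show ?thesis by (simp only: ereal_less_eq)
  qed
  then have "ereal (real N * ln 6 + 4/9 * ln 5) \<le> limsup (?f \<circ> r)"
    by (intro le_Limsup always_eventually) auto
  also have "\<dots> \<le> limsup ?f" by (rule limsup_subseq_mono[OF mono])
  finally show ?thesis .
qed

text \<open>\<open>5^4 = 625 > 512 = 2^9\<close>; this is why blocks of \<open>12 a\<close> digits in \<open>27 a\<close> times, a proportion of \<open>4/9\<close>, are long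
enough.\<close>

lemma ln_2_less: "ln 2 < 4/9 * ln (5::real)"
proof -
  have "ln ((2::real) ^ 9) = real 9 * ln 2" by (rule ln_realpow)
  moreover have "ln ((5::real) ^ 4) = real 4 * ln 5" by (rule ln_realpow)
  moreover have "ln ((2::real) ^ 9) < ln (5 ^ 4)" by simp
  ultimately show ?thesis by simp
qed

lemma sep_rate_system:
  "hub_isolated A \<Longrightarrow> sep_rate (system A h) shift \<delta> = (\<lambda>T. ereal (ln (real (sep_size A h T \<delta>)) / real T))"
  by (rule ext) (simp add: sep_rate_def mspace_system)

lemma span_rate_system:
  "hub_isolated A \<Longrightarrow> span_rate (system A h) shift \<delta> = (\<lambda>T. ereal (ln (real (span_size A h T \<delta>)) / real T))"
  by (rule ext) (simp add: span_rate_def mspace_system)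

lemma points_nonempty: "points h \<noteq> {}"
  using zero_track[of h] by (auto simp: points_def)

text \<open>The number of tracks that are fully visible at scale \<open>\<delta>\<close>.\<close>

lemma resolved_tracks:
  assumes "0 < (\<delta>::real)"
  shows "\<exists>N. (1/3) ^ N / 2 < \<delta> \<and> (\<forall>m<N. \<delta> \<le> (1/3) ^ m / 2)"
proof -
  obtain M where "(1/3::real) ^ M < \<delta>" using real_arch_pow_inv[OF assms, of "1/3"] by auto
  moreover have "(1/3::real) ^ M / 2 \<le> (1/3) ^ M" by simp
  ultimately have "(1/3::real) ^ M / 2 < \<delta>" by linarith
  then have "\<exists>N. (1/3) ^ N / 2 < \<delta> \<and> (\<forall>m<N. \<not> (1/3) ^ m / 2 < \<delta>)" by (rule exists_least_iff[THEN iffD1, OF exI])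
  then show ?thesis by (simp only: not_less)
qed

section \<open>The three systems\<close>

text \<open>The pentagon on the left and its complement, again a pentagon, on the right.\<close>

definition pentagon :: digit_graph where
  "pentagon s d d' \<longleftrightarrow> d < 5 \<and> d' < 5 \<and> d \<noteq> d' \<and> (s = 1 \<longleftrightarrow> (d + 1) mod 5 = d' \<or> (d' + 1) mod 5 = d)"

definition complete_graph :: digit_graph where
  "complete_graph s d d' \<longleftrightarrow> d < 5 \<and> d' < 5 \<and> d \<noteq> d'"

lemma hub_isolated_pentagon: "hub_isolated pentagon"
  by (auto simp: hub_isolated_def pentagon_def)

lemma hub_isolated_complete_graph: "hub_isolated complete_graph"
  by (auto simp: hub_isolated_def complete_graph_def)

lemma covering_pentagon: "covering pentagon"
  by (auto simp: covering_def pentagon_def)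

lemma covering_complete_graph: "covering complete_graph"
  by (auto simp: covering_def complete_graph_def)

lemma triangle_free_pentagon: "triangle_free pentagon"
proof -
  have digits: "d \<in> {0, 1, 2, 3, 4}" if "d < 5" for d :: nat using that by auto
  have check: "\<forall>u\<in>{0, 1, 2, 3, 4}. \<forall>v\<in>{0, 1, 2, 3, 4}. \<forall>w\<in>{0, 1, 2, 3, 4}.
      \<not> (pentagon s u v \<and> pentagon s v w \<and> pentagon s u w)" for s
    by (cases "s = 1") (simp_all add: pentagon_def)
  have "\<not> (pentagon s u v \<and> pentagon s v w \<and> pentagon s u w)" for s u v w
  proof
    assume *: "pentagon s u v \<and> pentagon s v w \<and> pentagon s u w"
    then have "u < 5" "v < 5" "w < 5" unfolding pentagon_def by blast+
    then show False using check digits * by blast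
  qed
  then show ?thesis by (simp add: triangle_free_def)
qed

lemma pentagon_sep_oscillates:
  "liminf (sep_rate (system pentagon h) shift ((1/3) ^ n)) < limsup (sep_rate (system pentagon h) shift ((1/3) ^ n))"
proof -
  note A = hub_isolated_pentagon
  have pos: "0 < sep_size pentagon h T ((1/3) ^ n)" if "0 < T" for T
    using span_size_pos[OF A that _ points_nonempty] span_size_le_sep_size[OF A that] by (meson less_le_trans zero_less_divide_1_iff zero_less_numeral zero_less_power)
  have "liminf (sep_rate (system pentagon h) shift ((1/3) ^ n)) \<le> ereal (real n * ln 6 + ln (real 2))"
    unfolding sep_rate_system[OF A]
    by (rule liminf_le_between_levels[OF _ pos]) (use sep_size_triangle_free_le[OF A triangle_free_pentagon] in auto)
  also have "\<dots> < ereal (real n * ln 6 + 4/9 * ln 5)" using ln_2_less by simp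
  also have "\<dots> \<le> limsup (sep_rate (system pentagon h) shift ((1/3) ^ n))"
    unfolding sep_rate_system[OF A]
    by (rule limsup_ge_at_levels) (rule sep_size_ge_blocks[OF A covering_pentagon])
  finally show ?thesis .
qed

text \<open>The constant \<open>c\<close> is the growth of track \<open>n\<close> per time step between the levels: 2 for the pentagons, whose
spanning sets are bounded by separated sets, and 1 for the complete graph, where hubs dominate.\<close>

lemma span_oscillates:
  assumes A: "hub_isolated A" "covering A" and c: "0 < c" "c \<le> 2"
    and upper: "\<And>T b. 0 < T \<Longrightarrow> (\<And>a. a \<in> levels \<Longrightarrow> 2 * a < T \<Longrightarrow> a \<le> b) \<Longrightarrow>
      span_size A False T ((1/3) ^ n) \<le> word_bound n T * ((T + 1) ^ 4 * ((b + 2) * 6 ^ (12 * b))) * c ^ T"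
  shows "liminf (span_rate (system A False) shift ((1/3) ^ n)) < limsup (span_rate (system A False) shift ((1/3) ^ n))"
proof -
  have "liminf (span_rate (system A False) shift ((1/3) ^ n)) \<le> ereal (real n * ln 6 + ln (real c))"
    unfolding span_rate_system[OF A(1)]
    by (rule liminf_le_between_levels[OF c(1) span_size_pos[OF A(1) _ _ points_nonempty]])
      (use upper in auto)
  also have "\<dots> \<le> ereal (real n * ln 6 + ln 2)" using c by simp
  also have "\<dots> < ereal (real n * ln 6 + 4/9 * ln 5)" using ln_2_less by simp
  also have "\<dots> \<le> limsup (span_rate (system A False) shift ((1/3) ^ n))"
    unfolding span_rate_system[OF A(1)]
    by (rule limsup_ge_at_levels) (rule span_size_ge_blocks[OF A])
  finally show ?thesis .
qed

lemma pentagon_span_oscillates: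
  "liminf (span_rate (system pentagon False) shift ((1/3) ^ n)) < limsup (span_rate (system pentagon False) shift ((1/3) ^ n))"
proof (rule span_oscillates[OF hub_isolated_pentagon covering_pentagon, of 2])
  fix T b assume T: "0 < T" and b: "\<And>a. a \<in> levels \<Longrightarrow> 2 * a < T \<Longrightarrow> a \<le> b"
  have "span_size pentagon False T ((1/3) ^ n) \<le> sep_size pentagon False T ((1/3) ^ n)"
    by (rule span_size_le_sep_size[OF hub_isolated_pentagon T]) simp
  also have "\<dots> \<le> word_bound n T * ((T + 1) ^ 4 * ((b + 2) * 6 ^ (12 * b))) * 2 ^ T"
    by (rule sep_size_triangle_free_le[OF hub_isolated_pentagon triangle_free_pentagon T b])
  finally show "span_size pentagon False T ((1/3) ^ n) \<le> word_bound n T * ((T + 1) ^ 4 * ((b + 2) * 6 ^ (12 * b))) * 2 ^ T" .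
qed auto

lemma complete_span_oscillates:
  "liminf (span_rate (system complete_graph False) shift ((1/3) ^ n)) < limsup (span_rate (system complete_graph False) shift ((1/3) ^ n))"
proof (rule span_oscillates[OF hub_isolated_complete_graph covering_complete_graph, of 1])
  fix T b assume T: "0 < T" and b: "\<And>a. a \<in> levels \<Longrightarrow> 2 * a < T \<Longrightarrow> a \<le> b"
  have "span_size complete_graph False T ((1/3) ^ n) \<le> word_bound n T * ((T + 1) ^ 4 * ((b + 2) * 6 ^ (12 * b)))"
    by (rule span_size_le_one_sided[OF hub_isolated_complete_graph T b])
  then show "span_size complete_graph False T ((1/3) ^ n) \<le> word_bound n T * ((T + 1) ^ 4 * ((b + 2) * 6 ^ (12 * b))) * 1 ^ T"
    by simp
qed auto

lemma pentagon_span_converges: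
  assumes "0 < \<delta>"
  shows "liminf (span_rate (system pentagon True) shift \<delta>) = limsup (span_rate (system pentagon True) shift \<delta>)"
proof -
  note A = hub_isolated_pentagon
  obtain N where N: "(1/3) ^ N / 2 < \<delta>" "\<And>m. m < N \<Longrightarrow> \<delta> \<le> (1/3) ^ m / 2"
    using resolved_tracks[OF assms] by blast
  show ?thesis
    unfolding span_rate_system[OF A]
    by (rule liminf_eq_limsup_of_rate, rule rate_tendsto[of 1 N])
      (use span_size_hub_bounds[OF A _ N] in auto)
qed

lemma complete_sep_converges:
  assumes "0 < \<delta>"
  shows "liminf (sep_rate (system complete_graph False) shift \<delta>) = limsup (sep_rate (system complete_graph False) shift \<delta>)"
proof -
  note A = hub_isolated_complete_graph
  obtain N where N: "(1/3) ^ N / 2 < \<delta>" "\<And>m. m < N \<Longrightarrow> \<delta> \<le> (1/3) ^ m / 2"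
    using resolved_tracks[OF assms] by blast
  define q :: nat where "q = (if \<delta> \<le> (1/3) ^ N then 5 else 1)"
  have c: "\<And>d d'. d < 5 \<Longrightarrow> d' < 5 \<Longrightarrow> d \<noteq> d' \<Longrightarrow> complete_graph 1 d d'" by (simp add: complete_graph_def)
  show ?thesis
    unfolding sep_rate_system[OF A]
  proof (rule liminf_eq_limsup_of_rate, rule rate_tendsto[of q N])
    fix T :: nat assume T: "0 < T"
    show "(6 ^ T) ^ N * q ^ T \<le> sep_size complete_graph False T \<delta>"
      by (rule sep_size_complete_bounds(1)[OF A c T N q_def])
    show "sep_size complete_graph False T \<delta> \<le> word_bound N T * ((T + 1) ^ 4 * q ^ T)"
      by (rule sep_size_complete_bounds(2)[OF A c T N q_def])
  qed (simp add: q_def)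
qed

theorem corollary5:
  shows "\<exists>(X :: point metric) (F\<^sub>X :: point \<Rightarrow> point)
            (W :: point metric) (F\<^sub>W :: point \<Rightarrow> point)
            (Z :: point metric) (H :: point \<Rightarrow> point).
     compact_homeo_system X F\<^sub>X \<and> compact_homeo_system W F\<^sub>W \<and> compact_homeo_system Z H \<and>
     (\<forall>n::nat.
        liminf (span_rate X F\<^sub>X (1 / 3 ^ n)) < limsup (span_rate X F\<^sub>X (1 / 3 ^ n)) \<and>
        liminf (sep_rate X F\<^sub>X (1 / 3 ^ n)) < limsup (sep_rate X F\<^sub>X (1 / 3 ^ n)) \<and>
        liminf (sep_rate W F\<^sub>W (1 / 3 ^ n)) < limsup (sep_rate W F\<^sub>W (1 / 3 ^ n)) \<and>
        liminf (span_rate Z H (1 / 3 ^ n)) < limsup (span_rate Z H (1 / 3 ^ n))) \<and>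
     (\<forall>\<delta>>0. liminf (span_rate W F\<^sub>W \<delta>) = limsup (span_rate W F\<^sub>W \<delta>)) \<and>
     (\<forall>\<delta>>0. liminf (sep_rate Z H \<delta>) = limsup (sep_rate Z H \<delta>))"
proof (intro exI conjI allI impI)
  show "compact_homeo_system (system pentagon False) shift" "compact_homeo_system (system pentagon True) shift"
    "compact_homeo_system (system complete_graph False) shift"
    by (rule compact_homeo_system_shift, rule hub_isolated_pentagon hub_isolated_complete_graph)+
  fix n :: nat
  have eq: "1 / 3 ^ n = (1/3::real) ^ n" by (simp add: power_one_over)
  show "liminf (span_rate (system pentagon False) shift (1 / 3 ^ n)) < limsup (span_rate (system pentagon False) shift (1 / 3 ^ n))"
    unfolding eq by (rule pentagon_span_oscillates)
  show "liminf (sep_rate (system pentagon False) shift (1 / 3 ^ n)) < limsup (sep_rate (system pentagon False) shift (1 / 3 ^ n))"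
    "liminf (sep_rate (system pentagon True) shift (1 / 3 ^ n)) < limsup (sep_rate (system pentagon True) shift (1 / 3 ^ n))"
    unfolding eq by (rule pentagon_sep_oscillates)+
  show "liminf (span_rate (system complete_graph False) shift (1 / 3 ^ n)) < limsup (span_rate (system complete_graph False) shift (1 / 3 ^ n))"
    unfolding eq by (rule complete_span_oscillates)
qed (simp_all add: pentagon_span_converges complete_sep_converges)

end
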